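(* For every positive integer $n$, there exists an RDSQS$(7\times 4^{n})$.
   Context: A Steiner quadruple system SQS$(v)$ is a pair $(X,\mathcal{B})$ where $X$ is a set of $v$ points and $\mathcal{B}$ is a collection of $4$-element subsets of $X$ (blocks) such that every $3$-element subset of $X$ is contained in exactly one block. For $x\in X$, the derived design at $x$ is the pair $(X\setminus\{x\},\mathcal{B}_x)$ with $\mathcal{B}_x=\{B\setminus\{x\}: x\in B,\ B\in\mathcal{B}\}$; it is a Steiner triple system on $v-1$ points (every pair of distinct points lies in exactly one of its triples). A collection of blocks on a point set $Y$ is resolvable if it can be partitioned into parallel classes, a parallel class being a set of blocks that partitions $Y$. An RDSQS$(v)$ is an SQS$(v)$ whose derived design at every point is resolvable (i.e. is a Kirkman triple system on $v-1$ points). *)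

theory Defs
  imports Main "HOL-Library.Disjoint_Sets"
begin

definition steiner_quadruple_system :: "nat \<Rightarrow> 'a set \<Rightarrow> 'a set set \<Rightarrow> bool" where
  "steiner_quadruple_system v X \<B> \<longleftrightarrow>
     finite X \<and> card X = v \<and>
     (\<forall>B\<in>\<B>. B \<subseteq> X \<and> card B = 4) \<and>
     (\<forall>T. T \<subseteq> X \<and> card T = 3 \<longrightarrow> (\<exists>!B. B \<in> \<B> \<and> T \<subseteq> B))"

definition derived_blocks :: "'a set set \<Rightarrow> 'a \<Rightarrow> 'a set set" where
  "derived_blocks \<B> x = {B - {x} | B. B \<in> \<B> \<and> x \<in> B}"

definition parallel_class :: "'a set \<Rightarrow> 'a set set \<Rightarrow> 'a set set \<Rightarrow> bool" where
  "parallel_class Y \<C> P \<longleftrightarrow> P \<subseteq> \<C> \<and> partition_on Y P"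

definition resolvable :: "'a set \<Rightarrow> 'a set set \<Rightarrow> bool" where
  "resolvable Y \<C> \<longleftrightarrow> (\<exists>R. partition_on \<C> R \<and> (\<forall>P\<in>R. parallel_class Y \<C> P))"

definition RDSQS :: "nat \<Rightarrow> 'a set \<Rightarrow> 'a set set \<Rightarrow> bool" where
  "RDSQS v X \<B> \<longleftrightarrow>
     steiner_quadruple_system v X \<B> \<and>
     (\<forall>x\<in>X. resolvable (X - {x}) (derived_blocks \<B> x))"

end

theory Submission
  imports Defs
begin

text \<open>
  The proof multiplies the number of points by four. Let a Steiner quadruple system on \<open>v\<close>
  points have resolvable derived designs, and take four levels of its point set, indexed by the
  field with four elements. A quadruple system on the \<open>4 * v\<close> new points has three kinds of
  blocks: the old blocks on each level; the bridges, which join an edge \<open>{a, b}\<close> of one level to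
  an edge \<open>{c, d}\<close> of another when both have the same colour in a one-factorization of the
  complete graph; and the transversals, with one point on each level, given by a Latin cube. The
  derived design at a point \<open>x\<close> then consists of the old derived design at \<open>x\<close>, of the triples
  \<open>{y, c, d}\<close> with \<open>{c, d}\<close> on another level and coloured like \<open>{x, y}\<close>, and of a Latin square of
  triples across the other three levels.

  Its parallel classes are sought in two shapes. A pure class joins a parallel class of the old
  derived design to a parallel class of the Latin square. In a mixed class every \<open>y\<close> on the level
  of \<open>x\<close> lies in a triple coming from a bridge; on the other three levels this is a set of
  \<open>v - 1\<close> edges, one of each colour, which triples of the Latin square complete to a partition.
  There are \<open>(v - 2) / 2\<close> pure and \<open>3 * v / 2\<close> mixed classes. So the step needs only a
  distribution of the Latin triples and of the edges of three complete graphs over such classes,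
  here called a gadget, and a gadget does not refer to the quadruple system at all
  (\<open>has_kirkman_sqs_quadruple\<close>).

  Gadgets are multiplied by four as well. Replace every point by four points. A Latin triple becomes
  sixteen triples, which split into four layers of four disjoint triples; an edge becomes a
  complete bipartite graph; and the edges inside a fourfold point bring three new colours. A mixed
  class lifts to four classes that only lack the new colours. To repair one of them, a layer over
  one triple of the class is broken into halves of two triples each: one half stays, and the points
  of the other half are covered by three edges, one on each level, of the three new colours.
  Exchanging the halves repairs a second lifted class, and costs that triple one more layer. So two
  triples of each mixed class are chosen. If the chosen triples form three parallel classes of the
  Latin square, then the layers left over form three additional pure classes, and the count
  \<open>4 * ((v - 2) / 2) + 3 = (4 * v - 2) / 2\<close> is met. The broken layers provide the choice for
  the next step.

  The lifting argument uses only how the layers over the triples are distributed. This weaker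
  structure, a layered gadget, is implied by a gadget (\<open>has_layered_gadgets_expand\<close>), implies a
  gadget on four times as many points (\<open>has_gadgets_lift\<close>), and exists on seven points, where a
  gadget is impossible because \<open>v\<close> must be even (\<open>has_layered_gadgets_7\<close>): there every triple
  and every edge is used twice, and the 21 mixed classes form one orbit of a group of order 21.

  The quadruple system on 28 points is the spherical geometry on the projective line over the field
  with 27 elements. Its derived designs are affine spaces of dimension three over the field with
  three elements, whose lines fall into parallel classes (\<open>has_kirkman_sqs_28\<close>).

  Throughout, the conditions on classes only ask that a class covers every point at least once. The
  number of classes equals the number of blocks through two points, so that a class cannot cover a
  point twice (\<open>resolvable_derived_blocks\<close>).
\<close>
section \<open>Four-element field and base-four coding of points\<close>

text \<open>
  The elements other than 0 and 1 are \<open>Fw\<close> and \<open>Fv = Fw + 1 = Fw * Fw\<close>. A concrete datatype makes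
  every identity between few variables a finite case distinction. The elements index the levels of
  the quadrupled systems and also the copies of a fourfold point.
\<close>
datatype f4 = F0 | F1 | Fw | Fv

instantiation f4 :: field
begin

definition "zero_f4 = F0"
definition "one_f4 = F1"

fun plus_f4 :: "f4 \<Rightarrow> f4 \<Rightarrow> f4" where
  "F0 + b = b" | "a + F0 = a"
| "F1 + F1 = F0" | "F1 + Fw = Fv" | "F1 + Fv = Fw"
| "Fw + F1 = Fv" | "Fw + Fw = F0" | "Fw + Fv = F1"
| "Fv + F1 = Fw" | "Fv + Fw = F1" | "Fv + Fv = F0"

fun times_f4 :: "f4 \<Rightarrow> f4 \<Rightarrow> f4" where
  "F0 * b = F0" | "a * F0 = F0" | "F1 * b = b" | "a * F1 = a"
| "Fw * Fw = Fv" | "Fw * Fv = F1" | "Fv * Fw = F1" | "Fv * Fv = Fw"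

fun inverse_f4 :: "f4 \<Rightarrow> f4" where
  "inverse F0 = F0" | "inverse F1 = F1" | "inverse Fw = Fv" | "inverse Fv = Fw"

definition "uminus_f4 (a::f4) = a"
definition "minus_f4 (a::f4) b = a + b"
definition "divide_f4 (a::f4) b = a * inverse b"

instance
proof
  fix a b c :: f4
  show "a + b + c = a + (b + c)" by (cases a; cases b; cases c) simp_all
  show "a + b = b + a" by (cases a; cases b) simp_all
  show "0 + a = a" by (simp add: zero_f4_def)
  show "- a + a = 0" by (cases a) (simp_all add: uminus_f4_def zero_f4_def)
  show "a - b = a + - b" by (simp add: uminus_f4_def minus_f4_def)
  show "a * b * c = a * (b * c)" by (cases a; cases b; cases c) simp_all
  show "a * b = b * a" by (cases a; cases b) simp_all
  show "1 * a = a" by (cases a) (simp_all add: one_f4_def)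
  show "(a + b) * c = a * c + b * c" by (cases a; cases b; cases c) simp_all
  show "(0::f4) \<noteq> 1" by (simp add: zero_f4_def one_f4_def)
  show "a \<noteq> 0 \<Longrightarrow> inverse a * a = 1"
    by (cases a) (simp_all add: zero_f4_def one_f4_def)
  show "a div b = a * inverse b" by (simp add: divide_f4_def)
  show "inverse (0::f4) = 0" by (simp add: zero_f4_def)
qed

end

lemmas f4_arith = zero_f4_def one_f4_def uminus_f4_def minus_f4_def divide_f4_def

lemma f4_UNIV: "(UNIV :: f4 set) = {F0, F1, Fw, Fv}"
  by (auto intro: f4.exhaust)

instance f4 :: finite
  by standard (simp add: f4_UNIV)

lemma all_f4: "(\<forall>a. P a) \<longleftrightarrow> P F0 \<and> P F1 \<and> P Fw \<and> P Fv"
  by (metis f4.exhaust)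

lemma ex_f4: "(\<exists>a. P a) \<longleftrightarrow> P F0 \<or> P F1 \<or> P Fw \<or> P Fv"
  by (metis f4.exhaust)

lemma card_f4: "card (UNIV :: f4 set) = 4"
  by (simp add: f4_UNIV)

lemma f4_add_self [simp]: "(a::f4) + a = 0"
  by (cases a) (simp_all add: f4_arith)

lemma f4_add_self' [simp]: "(a::f4) + (a + b) = b"
  by (simp add: add.assoc [symmetric])

lemma f4_add_eq_0 [simp]: "(a::f4) + b = 0 \<longleftrightarrow> a = b"
  by (cases a; cases b) (simp_all add: f4_arith)

lemma f4_add_eq: "(a::f4) + b = c \<longleftrightarrow> a = b + c"
  by (cases a; cases b; cases c) (simp_all add: f4_arith)

fun code :: "f4 \<Rightarrow> nat" where
  "code F0 = 0" | "code F1 = 1" | "code Fw = 2" | "code Fv = 3"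

text \<open>
  Points are natural numbers at every stage; \<open>pt c a\<close> is the copy number \<open>a\<close> of the point \<open>c\<close>, so
  that \<open>{..<4 * v}\<close> is again the product of \<open>{..<v}\<close> with the field.
\<close>
definition pt :: "nat \<Rightarrow> f4 \<Rightarrow> nat" where "pt c a = 4 * c + code a"
definition hi :: "nat \<Rightarrow> nat" where "hi y = y div 4"
definition lo :: "nat \<Rightarrow> f4" where
  "lo y = (if y mod 4 = 0 then F0 else if y mod 4 = 1 then F1 else if y mod 4 = 2 then Fw else Fv)"

lemma hi_pt [simp]: "hi (pt c a) = c"
  by (cases a) (simp_all add: hi_def pt_def)

lemma lo_pt [simp]: "lo (pt c a) = a"
  by (cases a) (simp_all add: lo_def pt_def, presburger+)

lemma pt_hi_lo [simp]: "pt (hi y) (lo y) = y"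
proof -
  have "y mod 4 = 0 \<or> y mod 4 = 1 \<or> y mod 4 = 2 \<or> y mod 4 = 3" by presburger
  then show ?thesis unfolding pt_def hi_def lo_def by (elim disjE) (simp_all, presburger+)
qed

lemma pt_eq_iff [simp]: "pt c a = pt d b \<longleftrightarrow> c = d \<and> a = b"
  by (metis hi_pt lo_pt)

lemma pt_less_iff [simp]: "pt c a < 4 * v \<longleftrightarrow> c < v"
  by (cases a) (auto simp: pt_def)

lemma hi_less_iff [simp]: "hi y < v \<longleftrightarrow> y < 4 * v"
  by (metis pt_hi_lo pt_less_iff)

lemma pt_exhaust: obtains c a where "y = pt c a"
  by (metis pt_hi_lo)

section \<open>From coloured blocks to resolvable derived designs\<close>

text \<open>
  The blocks through \<open>x\<close> and \<open>y\<close>, with these two points removed, partition the other points into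
  pairs.
\<close>
lemma card_blocks_through_pair:
  assumes "steiner_quadruple_system v X B" "x \<in> X" "y \<in> X" "x \<noteq> y"
  shows "2 * card {b \<in> B. x \<in> b \<and> y \<in> b} + 2 = v"
proof -
  let ?B = "{b \<in> B. x \<in> b \<and> y \<in> b}"
  have fin: "finite X" and card_X: "card X = v"
    and block: "\<And>b. b \<in> B \<Longrightarrow> b \<subseteq> X \<and> card b = 4"
    and unique: "\<And>T. T \<subseteq> X \<Longrightarrow> card T = 3 \<Longrightarrow> \<exists>!b. b \<in> B \<and> T \<subseteq> b"
    using assms(1) unfolding steiner_quadruple_system_def by blast+
  have B: "finite ?B" using fin block by (intro finite_subset[of ?B "Pow X"]) auto
  have triple: "card {x, y, z} = 3" "{x, y, z} \<subseteq> X" if "z \<in> X - {x, y}" for z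
    using that assms by auto
  have "card (\<Union>b\<in>?B. b - {x, y}) = (\<Sum>b\<in>?B. card (b - {x, y}))"
  proof (rule card_UN_disjoint)
    show "finite ?B" by fact
    show "\<forall>b\<in>?B. finite (b - {x, y})"
      using block fin by (auto intro: finite_subset)
    show "\<forall>b\<in>?B. \<forall>c\<in>?B. b \<noteq> c \<longrightarrow> (b - {x, y}) \<inter> (c - {x, y}) = {}"
    proof (intro ballI impI, rule ccontr)
      fix b c assume bc: "b \<in> ?B" "c \<in> ?B" "b \<noteq> c" "(b - {x, y}) \<inter> (c - {x, y}) \<noteq> {}"
      then obtain z where z: "z \<in> b" "z \<in> c" "z \<noteq> x" "z \<noteq> y" by auto
      then have "z \<in> X - {x, y}" using block bc by auto
      with unique[OF triple(2,1)[OF this]] bc z show False by auto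
    qed
  qed
  also have "(\<Sum>b\<in>?B. card (b - {x, y})) = (\<Sum>b\<in>?B. 2)"
    using assms block by (intro sum.cong) (auto simp: card_Diff_subset)
  also have "(\<Union>b\<in>?B. b - {x, y}) = X - {x, y}"
  proof (intro equalityI subsetI)
    fix z assume z: "z \<in> X - {x, y}"
    from unique[OF triple(2,1)[OF z]] z show "z \<in> (\<Union>b\<in>?B. b - {x, y})" by auto
  qed (use block in auto)
  finally have "card (X - {x, y}) = 2 * card ?B" by simp
  moreover have "card (X - {x, y}) + 2 = v"
    using assms fin card_X card_mono[of X "{x, y}"] by (simp add: card_Diff_subset)
  ultimately show ?thesis by simp
qed

text \<open>
  A resolution of the derived design at \<open>x\<close> is given as a colouring \<open>f\<close> of the blocks through \<open>x\<close>
  in which every colour occurs at every other point. The number of colours makes this equivalent to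
  resolvability; it is the form in which the classes are constructed.
\<close>
definition has_kirkman_sqs :: "nat \<Rightarrow> bool" where
  "has_kirkman_sqs v \<longleftrightarrow> (\<exists>B. steiner_quadruple_system v {..<v} B \<and>
     (\<forall>x<v. \<exists>(f :: nat set \<Rightarrow> nat) P. finite P \<and> 2 * card P + 2 = v \<and>
        (\<forall>p\<in>P. \<forall>y<v. y \<noteq> x \<longrightarrow> (\<exists>b\<in>B. x \<in> b \<and> y \<in> b \<and> f b = p))))"

text \<open>
  As many blocks pass through \<open>x\<close> and \<open>y\<close> as there are colours. Hence \<open>f\<close>, which is onto the set
  of colours on these blocks, is injective on them: two blocks of one colour meet only in \<open>x\<close>.
\<close>
lemma resolvable_derived_blocks:
  assumes sqs: "steiner_quadruple_system v X B" and v: "v \<ge> 4" and x: "x \<in> X"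
    and P: "finite P" "2 * card P + 2 = v"
    and cover: "\<And>p y. p \<in> P \<Longrightarrow> y \<in> X \<Longrightarrow> y \<noteq> x \<Longrightarrow> \<exists>b\<in>B. x \<in> b \<and> y \<in> b \<and> f b = p"
  shows "resolvable (X - {x}) (derived_blocks B x)"
proof -
  have fin: "finite X" and block: "\<And>b. b \<in> B \<Longrightarrow> b \<subseteq> X \<and> card b = 4"
    using sqs unfolding steiner_quadruple_system_def by blast+
  have bij: "inj_on f {b \<in> B. x \<in> b \<and> y \<in> b}" "f ` {b \<in> B. x \<in> b \<and> y \<in> b} = P"
    if "y \<in> X" "y \<noteq> x" for y
  proof -
    let ?B = "{b \<in> B. x \<in> b \<and> y \<in> b}"
    have B: "finite ?B" using fin block by (intro finite_subset[of ?B "Pow X"]) auto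
    have card: "card ?B = card P" using card_blocks_through_pair[OF sqs x that(1)] that P by simp
    have "P \<subseteq> f ` ?B" using cover that by fastforce
    then have "f ` ?B = P" using card_image_le[OF B, of f] card B
      by (metis card_seteq finite_imageI)
    then show "f ` ?B = P" "inj_on f ?B" using B card by (auto intro: eq_card_imp_inj_on)
  qed
  have other: "\<exists>y. y \<in> b \<and> y \<noteq> x \<and> y \<in> X" if "b \<in> B" for b
  proof -
    have "\<not> b \<subseteq> {x}" using block[OF that] card_mono[of "{x}" b] by auto
    then show ?thesis using block[OF that] by blast
  qed
  define C where "C p = {b - {x} | b. b \<in> B \<and> x \<in> b \<and> f b = p}" for p
  obtain y where y: "y \<in> X" "y \<noteq> x"
  proof -
    have "card X = v" using sqs by (simp add: steiner_quadruple_system_def)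
    then have "\<not> X \<subseteq> {x}" using v card_mono[of "{x}" X] by auto
    then show ?thesis using that by blast
  qed
  have "partition_on (derived_blocks B x) (C ` P)"
  proof (rule partition_onI)
    show "\<Union> (C ` P) = derived_blocks B x"
    proof (intro equalityI subsetI)
      fix t assume "t \<in> derived_blocks B x"
      then obtain b where b: "b \<in> B" "x \<in> b" "t = b - {x}"
        unfolding derived_blocks_def by blast
      obtain z where z: "z \<in> b" "z \<noteq> x" "z \<in> X" using other[OF b(1)] by blast
      have "f b \<in> P" using bij(2)[OF z(3,2)] b z by auto
      then show "t \<in> \<Union> (C ` P)" using b by (auto simp: C_def)
    next
      fix t assume "t \<in> \<Union> (C ` P)"
      then show "t \<in> derived_blocks B x" unfolding C_def derived_blocks_def by blast
    qed
  next
    fix c d assume "c \<in> C ` P" "d \<in> C ` P" "c \<noteq> d"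
    then obtain p q where pq: "c = C p" "d = C q" "p \<noteq> q" by blast
    show "disjnt c d"
    proof (rule ccontr)
      assume "\<not> disjnt c d"
      then obtain a b where "x \<in> a" "x \<in> b" "a - {x} = b - {x}" "f a = p" "f b = q"
        unfolding disjnt_def pq C_def by blast
      then show False using pq(3) by (metis insert_Diff)
    qed
  next
    show "{} \<notin> C ` P" using cover[OF _ y] unfolding C_def by blast
  qed
  moreover have "parallel_class (X - {x}) (derived_blocks B x) c" if c: "c \<in> C ` P" for c
    unfolding parallel_class_def
  proof (intro conjI partition_onI)
    from c obtain p where p: "p \<in> P" "c = C p" by auto
    show "c \<subseteq> derived_blocks B x" using p by (auto simp: C_def derived_blocks_def)
    show "\<Union> c = X - {x}"
    proof (intro equalityI subsetI)
      fix z assume "z \<in> X - {x}"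
      then show "z \<in> \<Union> c" using cover[OF p(1), of z] by (auto simp: p C_def)
    qed (use p block in \<open>auto simp: C_def\<close>)
    fix s t assume "s \<in> c" "t \<in> c" "s \<noteq> t"
    then obtain a b where ab: "a \<in> B" "b \<in> B" "x \<in> a" "x \<in> b" "f a = p" "f b = p"
      "s = a - {x}" "t = b - {x}" "a \<noteq> b" by (auto simp: p C_def)
    show "disjnt s t"
    proof (rule ccontr)
      assume "\<not> disjnt s t"
      then obtain z where z: "z \<in> a" "z \<in> b" "z \<noteq> x" using ab by (auto simp: disjnt_def)
      then have "z \<in> X" using block ab by auto
      from inj_onD[OF bij(1)[OF this z(3)], of a b] ab z show False by auto
    qed
  next
    show "{} \<notin> c"
    proof
      assume "{} \<in> c"
      then obtain b where "b \<in> B" "{} = b - {x}" using c unfolding C_def by blast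
      then show False using other[of b] by blast
    qed
  qed
  ultimately show ?thesis unfolding resolvable_def by blast
qed

lemma RDSQS_if_kirkman_sqs:
  assumes "has_kirkman_sqs v" "v \<ge> 4"
  shows "\<exists>B. RDSQS v {..<v} B"
proof -
  obtain B where B: "steiner_quadruple_system v {..<v} B"
    and f: "\<And>x. x < v \<Longrightarrow> \<exists>(f :: nat set \<Rightarrow> nat) P. finite P \<and> 2 * card P + 2 = v \<and>
        (\<forall>p\<in>P. \<forall>y<v. y \<noteq> x \<longrightarrow> (\<exists>b\<in>B. x \<in> b \<and> y \<in> b \<and> f b = p))"
    using assms unfolding has_kirkman_sqs_def by blast
  have "resolvable ({..<v} - {x}) (derived_blocks B x)" if "x < v" for x
  proof -
    from f[OF that] obtain f :: "nat set \<Rightarrow> nat" and P where "finite P" "2 * card P + 2 = v"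
      "\<And>p y. p \<in> P \<Longrightarrow> y < v \<Longrightarrow> y \<noteq> x \<Longrightarrow> \<exists>b\<in>B. x \<in> b \<and> y \<in> b \<and> f b = p" by blast
    with B assms(2) that show ?thesis by (intro resolvable_derived_blocks[of v _ _ _ P f]) auto
  qed
  then show ?thesis using B by (auto simp: RDSQS_def)
qed

section \<open>Gadgets\<close>

text \<open>
  A Latin cube is a set of quadruples \<open>T\<close>, one entry for each level, in which any three entries
  determine the fourth. The condition \<open>shift\<close> lets the level of a given point be moved to level 0,
  so that derived designs need to be studied only at points of level 0.
\<close>
locale cube =
  fixes v :: nat and L :: "(f4 \<Rightarrow> nat) set"
  assumes less: "T \<in> L \<Longrightarrow> T j < v"
    and shift: "T \<in> L \<Longrightarrow> (\<lambda>j. T (j + k)) \<in> L"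
    and fill: "(\<And>i. S i < v) \<Longrightarrow> \<exists>T\<in>L. \<forall>i. i \<noteq> j \<longrightarrow> T i = S i"
    and unique: "T \<in> L \<Longrightarrow> T' \<in> L \<Longrightarrow> (\<And>i. i \<noteq> j \<Longrightarrow> T i = T' i) \<Longrightarrow> T = T'"

text \<open>
  The colour classes of \<open>col\<close> are perfect matchings. That each of them reaches every point is
  expressed by transporting the colour of an edge \<open>{c, d}\<close> to a point \<open>x\<close>, so that the set of
  colours need not be named.
\<close>
locale one_factorization =
  fixes v :: nat and col :: "nat \<Rightarrow> nat \<Rightarrow> nat"
  assumes col_sym: "col c d = col d c"
    and col_inj: "c < v \<Longrightarrow> d < v \<Longrightarrow> e < v \<Longrightarrow> d \<noteq> c \<Longrightarrow> e \<noteq> c \<Longrightarrow> col c d = col c e \<Longrightarrow> d = e"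
    and col_everywhere: "x < v \<Longrightarrow> c < v \<Longrightarrow> d < v \<Longrightarrow> c \<noteq> d \<Longrightarrow> \<exists>y<v. y \<noteq> x \<and> col x y = col c d"

definition through :: "(f4 \<Rightarrow> nat) set \<Rightarrow> nat \<Rightarrow> f4 \<Rightarrow> nat \<Rightarrow> (f4 \<Rightarrow> nat) set" where
  "through L x j c = {T \<in> L. T 0 = x \<and> T j = c}"

text \<open>
  The class of a Latin triple \<open>T\<close>. \<open>Chosen r m h\<close> means that \<open>T\<close> lies in the mixed class \<open>r\<close> and
  is its first or second chosen triple according to \<open>h\<close>; the nonzero element \<open>m\<close> names the one of
  three parallel classes of chosen triples that contains \<open>T\<close>.
\<close>
datatype mark = Pure nat | Mixed nat | Chosen nat f4 bool

text \<open>
  The gadget at the point \<open>x\<close> of level 0. The sets \<open>P\<close> and \<open>R\<close> label the pure and the mixed classes,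
  \<open>f\<close> assigns a class to every Latin triple, that is, to every \<open>T\<close> in \<open>L\<close> with \<open>T 0 = x\<close>, and
  \<open>g j c d\<close> is the mixed class that contains the edge \<open>{c, d}\<close> of level \<open>j\<close>. In \<open>rainbow\<close> the
  colours are listed as those of the edges \<open>{x, y}\<close>, since \<open>y\<close> is the point that completes an edge
  of this colour to a triple of the derived design. The last two conditions prepare the
  multiplication of the gadget by four.
\<close>
locale gadget =
  fixes v :: nat and L :: "(f4 \<Rightarrow> nat) set" and col :: "nat \<Rightarrow> nat \<Rightarrow> nat" and x :: nat
    and P R :: "nat set" and f :: "(f4 \<Rightarrow> nat) \<Rightarrow> mark" and g :: "f4 \<Rightarrow> nat \<Rightarrow> nat \<Rightarrow> nat"
  assumes finite_P: "finite P" and finite_R: "finite R"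
    and card_P: "2 * card P + 2 = v" and card_R: "2 * card R = 3 * v"
    and g_sym: "g j c d = g j d c"
    and pure: "p \<in> P \<Longrightarrow> j \<noteq> 0 \<Longrightarrow> c < v \<Longrightarrow> \<exists>T\<in>through L x j c. f T = Pure p"
    and mixed: "r \<in> R \<Longrightarrow> j \<noteq> 0 \<Longrightarrow> c < v \<Longrightarrow>
      (\<exists>T\<in>through L x j c. f T = Mixed r \<or> (\<exists>m h. m \<noteq> 0 \<and> f T = Chosen r m h)) \<or>
      (\<exists>d<v. d \<noteq> c \<and> g j c d = r)"
    and rainbow: "r \<in> R \<Longrightarrow> y < v \<Longrightarrow> y \<noteq> x \<Longrightarrow>
      \<exists>j c d. j \<noteq> 0 \<and> c < v \<and> d < v \<and> c \<noteq> d \<and> col c d = col x y \<and> g j c d = r"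
    and chosen: "r \<in> R \<Longrightarrow> \<exists>T\<in>L. T 0 = x \<and> (\<exists>m. m \<noteq> 0 \<and> f T = Chosen r m h)"
    and chosen_unique: "m \<noteq> 0 \<Longrightarrow> j \<noteq> 0 \<Longrightarrow> c < v \<Longrightarrow>
      \<exists>!T. T \<in> through L x j c \<and> (\<exists>r h. f T = Chosen r m h)"

definition has_gadgets :: "nat \<Rightarrow> bool" where
  "has_gadgets v \<longleftrightarrow> (\<exists>L col. cube v L \<and> one_factorization v col \<and>
     (\<forall>x<v. \<exists>P R f g. gadget v L col x P R f g))"

section \<open>Quadrupling a Steiner quadruple system\<close>

definition level :: "f4 \<Rightarrow> nat set \<Rightarrow> nat set" where
  "level k b = (\<lambda>z. pt z k) ` b"
definition bridge :: "f4 \<Rightarrow> f4 \<Rightarrow> nat \<Rightarrow> nat \<Rightarrow> nat \<Rightarrow> nat \<Rightarrow> nat set" where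
  "bridge k l a b c d = {pt a k, pt b k, pt c l, pt d l}"
definition transversal :: "(f4 \<Rightarrow> nat) \<Rightarrow> nat set" where
  "transversal T = range (\<lambda>j. pt (T j) j)"

lemma pt_in_level [simp]: "pt a i \<in> level k b \<longleftrightarrow> i = k \<and> a \<in> b"
  by (auto simp: level_def)
lemma pt_in_bridge [simp]: "pt a' i \<in> bridge k l a b c d \<longleftrightarrow>
    i = k \<and> (a' = a \<or> a' = b) \<or> i = l \<and> (a' = c \<or> a' = d)"
  by (auto simp: bridge_def)
lemma pt_in_transversal [simp]: "pt a i \<in> transversal T \<longleftrightarrow> T i = a"
  by (auto simp: transversal_def)

definition quadruple :: "nat \<Rightarrow> (f4 \<Rightarrow> nat) set \<Rightarrow> (nat \<Rightarrow> nat \<Rightarrow> nat) \<Rightarrow> nat set set \<Rightarrow> nat set set" where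
  "quadruple v L col B =
     {level k b | k b. b \<in> B} \<union>
     {bridge k l a b c d | k l a b c d. k \<noteq> l \<and> a < v \<and> b < v \<and> c < v \<and> d < v \<and>
        a \<noteq> b \<and> c \<noteq> d \<and> col a b = col c d} \<union>
     transversal ` L"

lemma quadruple_cases:
  assumes "u \<in> quadruple v L col B"
  obtains (level) k b where "u = level k b" "b \<in> B"
  | (bridge) k l a b c d where "u = bridge k l a b c d" "k \<noteq> l" "a < v" "b < v" "c < v" "d < v"
      "a \<noteq> b" "c \<noteq> d" "col a b = col c d"
  | (transversal) T where "u = transversal T" "T \<in> L"
  using assms unfolding quadruple_def by blast

lemma levelI: "w \<in> B \<Longrightarrow> level k w \<in> quadruple v L col B"
  and bridgeI: "k \<noteq> l \<Longrightarrow> a < v \<Longrightarrow> b < v \<Longrightarrow> c < v \<Longrightarrow> d < v \<Longrightarrow> a \<noteq> b \<Longrightarrow> c \<noteq> d \<Longrightarrow>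
     col a b = col c d \<Longrightarrow> bridge k l a b c d \<in> quadruple v L col B"
  and transversalI: "T \<in> L \<Longrightarrow> transversal T \<in> quadruple v L col B"
  unfolding quadruple_def by blast+

text \<open>
  A triple of points on three levels leaves one level \<open>n\<close> for the fourth point of a transversal.
\<close>
lemma f4_fourth:
  fixes k l m :: f4
  assumes "k \<noteq> l" "k \<noteq> m" "l \<noteq> m"
  obtains n where "\<And>i. i \<noteq> n \<Longrightarrow> i = k \<or> i = l \<or> i = m" "n \<noteq> k" "n \<noteq> l" "n \<noteq> m"
proof -
  have "\<exists>n. (\<forall>i. i \<noteq> n \<longrightarrow> i = k \<or> i = l \<or> i = m) \<and> n \<noteq> k \<and> n \<noteq> l \<and> n \<noteq> m"
    unfolding ex_f4 all_f4 using assms by (cases k; cases l; cases m) simp_all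
  then show ?thesis using that by blast
qed

locale quadrupling = cube v L + one_factorization v col
  for v L col +
  fixes B :: "nat set set"
  assumes sqs: "steiner_quadruple_system v {..<v} B"
begin

lemma block: "b \<in> B \<Longrightarrow> b \<subseteq> {..<v} \<and> card b = 4"
  using sqs unfolding steiner_quadruple_system_def by blast

lemma block_unique: "T \<subseteq> {..<v} \<Longrightarrow> card T = 3 \<Longrightarrow> \<exists>!b. b \<in> B \<and> T \<subseteq> b"
  using sqs unfolding steiner_quadruple_system_def by blast

lemma block_eqI:
  "T \<subseteq> {..<v} \<Longrightarrow> card T = 3 \<Longrightarrow> b \<in> B \<Longrightarrow> c \<in> B \<Longrightarrow> T \<subseteq> b \<Longrightarrow> T \<subseteq> c \<Longrightarrow> b = c"
  using block_unique[of T] by (metis (no_types))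

abbreviation "Q \<equiv> quadruple v L col B"

lemma triple_one_level:
  assumes "a < v" "b < v" "c < v" "a \<noteq> b" "a \<noteq> c" "b \<noteq> c"
  shows "\<exists>!u. u \<in> Q \<and> {pt a k, pt b k, pt c k} \<subseteq> u"
proof -
  have abc: "{a, b, c} \<subseteq> {..<v}" "card {a, b, c} = 3" using assms by auto
  obtain w where w: "w \<in> B" "{a, b, c} \<subseteq> w" using ex1_implies_ex[OF block_unique[OF abc]] by blast
  note uniq = block_eqI[OF abc _ w(1) _ w(2)]
  show ?thesis
  proof (rule ex1I[of _ "level k w"])
    show "level k w \<in> Q \<and> {pt a k, pt b k, pt c k} \<subseteq> level k w"
      using w levelI by auto
  next
    fix u assume u: "u \<in> Q \<and> {pt a k, pt b k, pt c k} \<subseteq> u"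
    then have "u \<in> Q" by simp
    then show "u = level k w"
    proof (cases rule: quadruple_cases)
      case (level k' w')
      with u have "k' = k" "{a, b, c} \<subseteq> w'" by auto
      with uniq[OF level(2)] level show ?thesis by simp
    next
      case bridge
      with u assms show ?thesis by auto
    next
      case transversal
      with u assms show ?thesis by auto
    qed
  qed
qed

text \<open>
  The fourth point is the partner of \<open>c\<close> in the matching that contains \<open>{a, b}\<close>.
\<close>
lemma triple_two_levels:
  assumes "a < v" "b < v" "c < v" "a \<noteq> b" "k \<noteq> l"
  shows "\<exists>!u. u \<in> Q \<and> {pt a k, pt b k, pt c l} \<subseteq> u"
proof -
  from col_everywhere[of c a b] assms obtain d where d: "d < v" "d \<noteq> c" "col c d = col a b" by auto
  show ?thesis
  proof (rule ex1I[of _ "bridge k l a b c d"])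
    show "bridge k l a b c d \<in> Q \<and> {pt a k, pt b k, pt c l} \<subseteq> bridge k l a b c d"
      using d assms by (intro conjI bridgeI) auto
  next
    fix u assume u: "u \<in> Q \<and> {pt a k, pt b k, pt c l} \<subseteq> u"
    then have "u \<in> Q" by simp
    then show "u = bridge k l a b c d"
    proof (cases rule: quadruple_cases)
      case level
      with u assms show ?thesis by auto
    next
      case transversal
      with u assms show ?thesis by auto
    next
      case (bridge k' l' a' b' c' d')
      have "\<exists>d'. d' < v \<and> d' \<noteq> c \<and> col c d' = col a b \<and> u = bridge k l a b c d'"
      proof (cases "k' = k")
        case True
        then have "l' = l" "a' = a \<and> b' = b \<or> a' = b \<and> b' = a" "c' = c \<or> d' = c"
          using u bridge assms by auto
        then show ?thesis using True bridge col_sym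
          by (elim disjE) (auto simp: bridge_def insert_commute)
      next
        case False
        then have "l' = k" "k' = l" "c' = a \<and> d' = b \<or> c' = b \<and> d' = a" "a' = c \<or> b' = c"
          using u bridge assms by auto
        then show ?thesis using bridge col_sym
          by (elim disjE) (auto simp: bridge_def insert_commute)
      qed
      then obtain d' where d': "d' < v" "d' \<noteq> c" "col c d' = col a b" "u = bridge k l a b c d'"
        by blast
      then have "d' = d" using d assms(3) by (intro col_inj[of c d' d]) simp_all
      then show ?thesis using d' by simp
    qed
  qed
qed

lemma triple_three_levels:
  assumes "a < v" "b < v" "c < v" "k \<noteq> l" "k \<noteq> m" "l \<noteq> m"
  shows "\<exists>!u. u \<in> Q \<and> {pt a k, pt b l, pt c m} \<subseteq> u"
proof -
  obtain n where n: "\<And>i. i \<noteq> n \<Longrightarrow> i = k \<or> i = l \<or> i = m" "n \<noteq> k" "n \<noteq> l" "n \<noteq> m"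
    using f4_fourth[OF assms(4-6)] by blast
  define S where "S i = (if i = k then a else if i = l then b else c)" for i
  have "S i < v" for i using assms by (simp add: S_def)
  from fill[of S n, OF this] obtain T where "T \<in> L" "\<forall>i. i \<noteq> n \<longrightarrow> T i = S i" by (rule bexE)
  then have T: "T \<in> L" "\<And>i. i \<noteq> n \<Longrightarrow> T i = S i" by simp_all
  show ?thesis
  proof (rule ex1I[of _ "transversal T"])
    show "transversal T \<in> Q \<and> {pt a k, pt b l, pt c m} \<subseteq> transversal T"
      using T n assms(4-6) by (auto simp: S_def transversalI)
  next
    fix u assume u: "u \<in> Q \<and> {pt a k, pt b l, pt c m} \<subseteq> u"
    then have "u \<in> Q" by simp
    then show "u = transversal T"
    proof (cases rule: quadruple_cases)
      case level
      with u assms show ?thesis by auto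
    next
      case bridge
      with u assms show ?thesis by auto
    next
      case (transversal T')
      have "T' = T"
      proof (rule unique[OF transversal(2) T(1)])
        fix i assume "i \<noteq> n"
        then show "T' i = T i" using T(2)[of i] n(1)[of i] u transversal assms(4-6) by (auto simp: S_def)
      qed
      then show ?thesis using transversal by simp
    qed
  qed
qed

lemma steiner_quadruple_system_quadruple:
  "steiner_quadruple_system (4 * v) {..<4 * v} Q"
  unfolding steiner_quadruple_system_def
proof (intro conjI ballI allI impI)
  fix u assume "u \<in> Q"
  then have "u \<subseteq> {..<4 * v} \<and> card u = 4"
  proof (cases rule: quadruple_cases)
    case (level k b)
    have "inj_on (\<lambda>z. pt z k) b" by (auto simp: inj_on_def)
    then show ?thesis using block[OF level(2)] level by (auto simp: level_def card_image)
  next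
    case bridge
    then show ?thesis by (auto simp: bridge_def)
  next
    case (transversal T)
    have "inj (\<lambda>j. pt (T j) j)" by (auto simp: inj_on_def)
    then show ?thesis using less[OF transversal(2)] transversal
      by (auto simp: transversal_def card_image card_f4)
  qed
  then show "u \<subseteq> {..<4 * v}" "card u = 4" by simp_all
next
  fix T :: "nat set" assume T: "T \<subseteq> {..<4 * v} \<and> card T = 3"
  then obtain y1 y2 y3 where y: "T = {y1, y2, y3}" "y1 \<noteq> y2" "y1 \<noteq> y3" "y2 \<noteq> y3"
    by (auto simp: card_3_iff)
  obtain a k b l c m where p: "y1 = pt a k" "y2 = pt b l" "y3 = pt c m"
    using pt_exhaust by metis
  have lt: "a < v" "b < v" "c < v" using T y p by auto
  consider "k = l" "k = m" | "k = l" "k \<noteq> m" | "k = m" "k \<noteq> l" | "l = m" "k \<noteq> l"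
    | "k \<noteq> l" "k \<noteq> m" "l \<noteq> m" by blast
  then show "\<exists>!u. u \<in> Q \<and> T \<subseteq> u"
  proof cases
    case 1
    with triple_one_level[of a b c k] y p lt show ?thesis by auto
  next
    case 2
    with triple_two_levels[of a b c k m] y p lt show ?thesis by auto
  next
    case 3
    with triple_two_levels[of a c b k l] y p lt show ?thesis by (auto simp: insert_commute)
  next
    case 4
    with triple_two_levels[of b c a l k] y p lt show ?thesis by (auto simp: insert_commute)
  next
    case 5
    with triple_three_levels[of a b c k l m] y p lt show ?thesis by auto
  qed
qed auto

end

definition class_of_mark :: "mark \<Rightarrow> nat" where
  "class_of_mark s = (case s of Pure p \<Rightarrow> 2 * p | Mixed r \<Rightarrow> 2 * r + 1 | Chosen r m h \<Rightarrow> 2 * r + 1)"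

text \<open>
  The class of a block through a point of level \<open>k\<close>, read off from the levels that the block meets:
  one level for an old block, all levels for a transversal, and two levels \<open>k\<close> and \<open>l\<close> for a bridge.
  Adding \<open>k\<close> to a level moves level \<open>k\<close> to level 0, where gadgets are stated. \<open>Min\<close> and \<open>Max\<close> only
  extract the two ends of an edge, in either order because \<open>g\<close> is symmetric. Pure classes get even
  and mixed classes odd labels.
\<close>
definition class_of_block ::
  "(nat set \<Rightarrow> nat) \<Rightarrow> ((f4 \<Rightarrow> nat) \<Rightarrow> mark) \<Rightarrow> (f4 \<Rightarrow> nat \<Rightarrow> nat \<Rightarrow> nat) \<Rightarrow> f4 \<Rightarrow> nat set \<Rightarrow> nat" where
  "class_of_block \<phi> f g k u =
     (if lo ` u = {k} then 2 * \<phi> (hi ` u)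
      else if lo ` u = UNIV then class_of_mark (f (\<lambda>j. THE a. pt a (j + k) \<in> u))
      else let l = (THE l. l \<in> lo ` u \<and> l \<noteq> k); E = {a. pt a l \<in> u}
           in 2 * g (l + k) (Min E) (Max E) + 1)"

lemma class_of_level: "b \<noteq> {} \<Longrightarrow> class_of_block \<phi> f g k (level k b) = 2 * \<phi> b"
proof -
  assume "b \<noteq> {}"
  then have "lo ` level k b = {k}" by (simp add: level_def image_image image_constant_conv)
  moreover have "hi ` level k b = b" by (simp add: level_def image_image)
  ultimately show ?thesis by (simp add: class_of_block_def)
qed

lemma class_of_transversal:
  "class_of_block \<phi> f g k (transversal T) = class_of_mark (f (\<lambda>j. T (j + k)))"
proof -
  have "lo ` transversal T = UNIV" by (simp add: transversal_def image_image)
  moreover have "UNIV \<noteq> {k}" by (cases k) (auto simp: f4_UNIV)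
  ultimately show ?thesis by (simp add: class_of_block_def)
qed

lemma class_of_bridge:
  assumes "k \<noteq> l" "c \<noteq> d" "\<And>j c d. g j c d = g j d c"
  shows "class_of_block \<phi> f g k (bridge k l a b c d) = 2 * g (l + k) c d + 1"
proof -
  have lo: "lo ` bridge k l a b c d = {k, l}" by (auto simp: bridge_def)
  have "card {k, l} = 2" using assms(1) by simp
  then have "{k, l} \<noteq> {k}" "{k, l} \<noteq> UNIV" using card_f4 by (intro notI; simp)+
  moreover have "(THE l'. l' \<in> {k, l} \<and> l' \<noteq> k) = l" using assms(1) by auto
  moreover have "{a'. pt a' l \<in> bridge k l a b c d} = {c, d}" using assms(1) by auto
  moreover have "g j (Min {c, d}) (Max {c, d}) = g j c d" for j
    using assms(3)[of j c d] by (auto simp: min_def max_def)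
  ultimately show ?thesis by (simp add: class_of_block_def lo Let_def)
qed

text \<open>
  In a pure class, the points of the level of \<open>x\<close> are covered by a parallel class of the old derived
  design and the points of the other levels by Latin triples. In a mixed class, a point \<open>y\<close> of the
  level of \<open>x\<close> is covered by the bridge over the edge of the class that has the colour of
  \<open>{x, y}\<close>, and a point of another level by the Latin triple or the edge of the class at it.
\<close>
lemma has_kirkman_sqs_quadruple:
  assumes "has_kirkman_sqs v" "has_gadgets v"
  shows "has_kirkman_sqs (4 * v)"
proof -
  obtain B where B: "steiner_quadruple_system v {..<v} B"
    and kirkman: "\<And>x. x < v \<Longrightarrow> \<exists>(f :: nat set \<Rightarrow> nat) P. finite P \<and> 2 * card P + 2 = v \<and>
        (\<forall>p\<in>P. \<forall>y<v. y \<noteq> x \<longrightarrow> (\<exists>b\<in>B. x \<in> b \<and> y \<in> b \<and> f b = p))"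
    using assms(1) unfolding has_kirkman_sqs_def by blast
  obtain L col where L: "cube v L" "one_factorization v col"
    and gad: "\<And>x. x < v \<Longrightarrow> \<exists>P R f g. gadget v L col x P R f g"
    using assms(2) unfolding has_gadgets_def by blast
  interpret quadrupling v L col B
    using L B by (simp add: quadrupling_def quadrupling_axioms_def)
  have "\<exists>(f :: nat set \<Rightarrow> nat) P. finite P \<and> 2 * card P + 2 = 4 * v \<and>
        (\<forall>p\<in>P. \<forall>y<4 * v. y \<noteq> x' \<longrightarrow> (\<exists>b\<in>Q. x' \<in> b \<and> y \<in> b \<and> f b = p))"
    if "x' < 4 * v" for x'
  proof -
    obtain x k where x': "x' = pt x k" by (rule pt_exhaust)
    then have x: "x < v" using that by simp
    obtain P R f g where "gadget v L col x P R f g" using gad[OF x] by blast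
    then interpret gadget v L col x P R f g .
    obtain \<phi>0 :: "nat set \<Rightarrow> nat" and P0 where P0: "finite P0" "2 * card P0 + 2 = v"
      and \<phi>0: "\<And>p y. p \<in> P0 \<Longrightarrow> y < v \<Longrightarrow> y \<noteq> x \<Longrightarrow> \<exists>b\<in>B. x \<in> b \<and> y \<in> b \<and> \<phi>0 b = p"
      using kirkman[OF x] by blast
    \<comment> \<open>Match the old parallel classes with the pure classes of the gadget.\<close>
    have "card P0 = card P" using P0(2) card_P by simp
    then obtain h where h: "bij_betw h P0 P"
      using finite_same_card_bij P0(1) finite_P by blast
    define \<phi> where "\<phi> = h \<circ> \<phi>0"
    have \<phi>: "\<exists>b\<in>B. x \<in> b \<and> y \<in> b \<and> \<phi> b = p" if "p \<in> P" "y < v" "y \<noteq> x" for p y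
    proof -
      from h \<open>p \<in> P\<close> obtain q where "q \<in> P0" "h q = p" by (auto simp: bij_betw_def)
      then show ?thesis using \<phi>0[of q y] that by (auto simp: \<phi>_def)
    qed
    let ?c = "class_of_block \<phi> f g k"
    \<comment> \<open>By the sizes of \<open>P\<close> and \<open>R\<close>, this is the number of blocks through two of the new points.\<close>
    define \<Lambda> where "\<Lambda> = (\<lambda>p. 2 * p) ` P \<union> (\<lambda>r. 2 * r + 1) ` R"
    have "card \<Lambda> = card P + card R"
      unfolding \<Lambda>_def
      by (subst card_Un_disjoint) (auto simp: finite_P finite_R card_image inj_on_def, presburger)
    then have \<Lambda>: "finite \<Lambda>" "2 * card \<Lambda> + 2 = 4 * v"
      using finite_P finite_R card_P card_R by (auto simp: \<Lambda>_def)
    have shifted: "\<exists>u\<in>Q. x' \<in> u \<and> pt c l \<in> u \<and> ?c u = class_of_mark (f T)"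
      if "T \<in> through L x (l + k) c" for T l c
    proof -
      have "(\<lambda>j. T (j + k)) \<in> L" using that shift by (simp add: through_def)
      moreover have "(\<lambda>j. T (j + k + k)) = T" by (simp add: add.assoc)
      ultimately show ?thesis using that x'
        by (intro bexI[of _ "transversal (\<lambda>j. T (j + k))"])
           (auto simp: class_of_transversal through_def transversalI)
    qed
    have "\<exists>u\<in>Q. x' \<in> u \<and> y' \<in> u \<and> ?c u = s" if s: "s \<in> \<Lambda>" and y': "y' < 4 * v" "y' \<noteq> x'" for s y'
    proof -
      obtain y l where y: "y' = pt y l" by (rule pt_exhaust)
      with y' have "y < v" by simp
      from s consider (pure) p where "p \<in> P" "s = 2 * p" | (rain) r where "r \<in> R" "s = 2 * r + 1"
        by (auto simp: \<Lambda>_def)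
      then show ?thesis
      proof cases
        case pure
        show ?thesis
        proof (cases "l = k")
          case True
          with \<phi>[OF pure(1) \<open>y < v\<close>] y y' x' obtain b where
            "b \<in> B" "x \<in> b" "y \<in> b" "\<phi> b = p" by auto
          moreover from this have "b \<noteq> {}" by auto
          ultimately show ?thesis using True pure x' y
            by (intro bexI[of _ "level k b"]) (auto simp: class_of_level levelI)
        next
          case False
          then have "l + k \<noteq> 0" by simp
          from gadget.pure[OF gadget_axioms pure(1) this \<open>y < v\<close>] obtain T where
            "T \<in> through L x (l + k) y" "f T = Pure p" by blast
          with shifted[OF this(1)] show ?thesis using pure y by (simp add: class_of_mark_def)
        qed
      next
        case rain
        show ?thesis
        proof (cases "l = k")
          case True
          with rainbow[OF rain(1) \<open>y < v\<close>] y y' x' obtain j c d where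
            *: "j \<noteq> 0" "c < v" "d < v" "c \<noteq> d" "col c d = col x y" "g j c d = r" by auto
          have "k \<noteq> k + j" "x \<noteq> y" using *(1) y y' x' True by (auto simp: f4_add_eq)
          with * show ?thesis using x \<open>y < v\<close> True x' y rain class_of_bridge[of k "k + j" c d g \<phi> f x y] g_sym
            by (intro bexI[of _ "bridge k (k + j) x y c d"] bridgeI) (auto simp: add_ac)
        next
          case False
          then have "l + k \<noteq> 0" by simp
          from mixed[OF rain(1) this \<open>y < v\<close>] consider
            T where "T \<in> through L x (l + k) y" "class_of_mark (f T) = s"
            | d where "d < v" "d \<noteq> y" "g (l + k) y d = r"
            using rain by (fastforce simp: class_of_mark_def)
          then show ?thesis
          proof cases
            case 1
            with shifted[OF 1(1)] show ?thesis using y by simp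
          next
            case (2 d)
            obtain z where z: "z < v" "z \<noteq> x" "col x z = col y d"
              using col_everywhere[OF x \<open>y < v\<close> 2(1)] 2(2) by auto
            show ?thesis using 2 z x \<open>y < v\<close> False x' y rain class_of_bridge[of k l y d g \<phi> f x z] g_sym
              by (intro bexI[of _ "bridge k l x z y d"] bridgeI) auto
          qed
        qed
      qed
    qed
    then show ?thesis using \<Lambda> by blast
  qed
  then show ?thesis using steiner_quadruple_system_quadruple unfolding has_kirkman_sqs_def by blast
qed

section \<open>Layered gadgets\<close>

text \<open>
  The class of one layer over a Latin triple. \<open>Split m r s\<close> is a layer that is broken, with one half in
  the mixed class \<open>r\<close> and the other in \<open>s\<close>; \<open>m\<close> has the same meaning as in \<open>Chosen\<close>.
\<close>
datatype layer_mark = LPure nat | LMixed nat | Split f4 nat nat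

text \<open>
  A gadget on \<open>4 * v\<close> points described over its \<open>v\<close> fourfold points. \<open>F T t\<close> is the class of the
  layer \<open>t\<close> over \<open>T\<close>, and \<open>G j c d a b\<close> is the class of the edge that joins copy \<open>a\<close> of \<open>c\<close> to
  copy \<open>b\<close> of \<open>d\<close>, for \<open>c \<noteq> d\<close>. The edges inside a fourfold point are absent, because the broken
  layers determine their classes.
\<close>
locale layered_gadget =
  fixes v :: nat and L :: "(f4 \<Rightarrow> nat) set" and col :: "nat \<Rightarrow> nat \<Rightarrow> f4 \<Rightarrow> f4 \<Rightarrow> nat" and x :: nat
    and P R :: "nat set" and F :: "(f4 \<Rightarrow> nat) \<Rightarrow> f4 \<Rightarrow> layer_mark"
    and G :: "f4 \<Rightarrow> nat \<Rightarrow> nat \<Rightarrow> f4 \<Rightarrow> f4 \<Rightarrow> nat"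
  assumes finite_P: "finite P" and finite_R: "finite R"
    and card_P: "2 * card P + 2 = 4 * v" and card_R: "2 * card R = 3 * (4 * v)"
    and G_sym: "c \<noteq> d \<Longrightarrow> G j c d a b = G j d c b a"
    and pure: "p \<in> P \<Longrightarrow> j \<noteq> 0 \<Longrightarrow> c < v \<Longrightarrow> \<exists>T\<in>through L x j c. \<exists>t. F T t = LPure p"
    and mixed: "r \<in> R \<Longrightarrow> j \<noteq> 0 \<Longrightarrow> c < v \<Longrightarrow>
      (\<exists>T\<in>through L x j c. \<exists>t. F T t = LMixed r) \<or>
      (\<exists>T\<in>through L x j c. \<exists>t m s. m \<noteq> 0 \<and> (F T t = Split m r s \<or> F T t = Split m s r)) \<or>
      (\<exists>d<v. d \<noteq> c \<and> (\<forall>a. \<exists>b. G j c d a b = r))"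
    and rainbow: "r \<in> R \<Longrightarrow> y < v \<Longrightarrow> y \<noteq> x \<Longrightarrow>
      \<exists>j c d a' b'. j \<noteq> 0 \<and> c < v \<and> d < v \<and> c \<noteq> d \<and>
        col c d a' b' = col x y a b \<and> G j c d a' b' = r"
    and split: "r \<in> R \<Longrightarrow>
      \<exists>T\<in>L. T 0 = x \<and> (\<exists>t m s. m \<noteq> 0 \<and> (F T t = Split m r s \<or> F T t = Split m s r))"
    and split_unique: "m \<noteq> 0 \<Longrightarrow> j \<noteq> 0 \<Longrightarrow> c < v \<Longrightarrow>
      \<exists>!z. fst z \<in> through L x j c \<and> (\<exists>r s. F (fst z) (snd z) = Split m r s)"

text \<open>
  The part of a one-factorization on \<open>4 * v\<close> points that concerns edges between different fourfold
  points, with the arguments of \<open>col\<close> as in \<open>layered_gadget\<close>.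
\<close>
locale layered_factorization =
  fixes v :: nat and col :: "nat \<Rightarrow> nat \<Rightarrow> f4 \<Rightarrow> f4 \<Rightarrow> nat"
  assumes col_sym: "c \<noteq> d \<Longrightarrow> col c d a b = col d c b a"
    and col_inj: "c < v \<Longrightarrow> d < v \<Longrightarrow> e < v \<Longrightarrow> d \<noteq> c \<Longrightarrow> e \<noteq> c \<Longrightarrow>
      col c d a b = col c e a b' \<Longrightarrow> d = e \<and> b = b'"
    and col_everywhere: "x < v \<Longrightarrow> c < v \<Longrightarrow> d < v \<Longrightarrow> c \<noteq> d \<Longrightarrow>
      \<exists>y<v. y \<noteq> x \<and> (\<exists>b'. col x y a' b' = col c d a b)"

definition has_layered_gadgets :: "nat \<Rightarrow> bool" where
  "has_layered_gadgets v \<longleftrightarrow> (\<exists>L col. cube v L \<and> layered_factorization v col \<and>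
     (\<forall>x<v. \<exists>P R F G. layered_gadget v L col x P R F G))"

text \<open>
  The product of \<open>L\<close> with the cube of all quadruples of field elements with sum 0.
\<close>
definition cube4 :: "(f4 \<Rightarrow> nat) set \<Rightarrow> (f4 \<Rightarrow> nat) set" where
  "cube4 L = {T. (\<lambda>j. hi (T j)) \<in> L \<and> lo (T F0) + lo (T F1) + lo (T Fw) + lo (T Fv) = 0}"

lemma cube4:
  assumes "cube v L"
  shows "cube (4 * v) (cube4 L)"
proof
  fix T j assume "T \<in> cube4 L"
  then show "T j < 4 * v" using cube.less[OF assms, of "\<lambda>j. hi (T j)" j] by (simp add: cube4_def)
next
  fix T k assume T: "T \<in> cube4 L"
  then have "(\<lambda>j. hi (T (j + k))) \<in> L"
    using cube.shift[OF assms] by (auto simp: cube4_def)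
  moreover have "lo (T (F0+k)) + lo (T (F1+k)) + lo (T (Fw+k)) + lo (T (Fv+k)) = 0"
    using T unfolding cube4_def mem_Collect_eq
    by (cases k) (simp_all only: plus_f4.simps add_ac)
  ultimately show "(\<lambda>j. T (j + k)) \<in> cube4 L" by (simp add: cube4_def)
next
  fix S :: "f4 \<Rightarrow> nat" and j assume "\<And>i. S i < 4 * v"
  then obtain T where T: "T \<in> L" "\<And>i. i \<noteq> j \<Longrightarrow> T i = hi (S i)"
    using cube.fill[OF assms, of "\<lambda>i. hi (S i)" j] by auto
  define s where "s = lo (S F0) + lo (S F1) + lo (S Fw) + lo (S Fv)"
  define T' where "T' = (\<lambda>i. if i = j then pt (T j) (lo (S j) + s) else S i)"
  have "(\<lambda>i. hi (T' i)) = T" by (auto simp: T'_def T)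
  moreover have "lo (T' F0) + lo (T' F1) + lo (T' Fw) + lo (T' Fv) = 0"
    by (cases j) (simp_all add: T'_def s_def f4_add_eq add_ac)
  ultimately have "T' \<in> cube4 L" using T by (simp add: cube4_def)
  then show "\<exists>T\<in>cube4 L. \<forall>i. i \<noteq> j \<longrightarrow> T i = S i"
    by (intro bexI [of _ T']) (simp_all add: T'_def)
next
  fix T T' j assume T: "T \<in> cube4 L" "T' \<in> cube4 L" "\<And>i. i \<noteq> j \<Longrightarrow> T i = T' i"
  have "(\<lambda>i. hi (T i)) = (\<lambda>i. hi (T' i))"
    using T by (intro cube.unique[OF assms, of _ _ j]) (simp_all add: cube4_def)
  then have "hi (T j) = hi (T' j)" by meson
  moreover have "lo (T j) = lo (T' j)"
    using T by (cases j) (auto simp: cube4_def f4_add_eq add_ac)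
  ultimately have "T j = T' j" by (metis pt_hi_lo)
  then show "T = T'" using T(3) by (metis ext)
qed

definition offset :: "f4 \<Rightarrow> f4 \<Rightarrow> f4 \<Rightarrow> f4" where
  "offset k t j = (case j of F0 \<Rightarrow> k | F1 \<Rightarrow> 0 | Fw \<Rightarrow> t | Fv \<Rightarrow> t + k)"

text \<open>
  The triple number \<open>e\<close> of layer \<open>t\<close> over \<open>T\<close>, for copy \<open>k\<close> of the point \<open>T 0\<close>. The four copies have
  sum 0, as \<open>cube4\<close> requires, because \<open>1 + Fw + Fv = 0\<close>. On a level \<open>j \<noteq> 0\<close> the copy
  \<open>j * e + offset k t j\<close> runs through the field with \<open>e\<close>; so the four triples of a layer partition
  the points over \<open>T\<close>.
\<close>
definition lift :: "f4 \<Rightarrow> (f4 \<Rightarrow> nat) \<Rightarrow> f4 \<Rightarrow> f4 \<Rightarrow> f4 \<Rightarrow> nat" where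
  "lift k T t e = (\<lambda>j. pt (T j) (j * e + offset k t j))"

definition base :: "(f4 \<Rightarrow> nat) \<Rightarrow> f4 \<Rightarrow> nat" where "base T = (\<lambda>j. hi (T j))"
definition layer :: "(f4 \<Rightarrow> nat) \<Rightarrow> f4" where "layer T = lo (T Fw) + Fw * lo (T F1)"
definition place :: "(f4 \<Rightarrow> nat) \<Rightarrow> f4" where "place T = lo (T F1)"

lemma base_lift [simp]: "base (lift k T t e) = T"
  by (simp add: base_def lift_def)

lemma layer_lift [simp]: "layer (lift k T t e) = t"
  by (cases t; cases e; cases k) (simp_all add: layer_def lift_def offset_def f4_arith)

lemma place_lift [simp]: "place (lift k T t e) = e"
  by (cases e) (simp_all add: place_def lift_def offset_def f4_arith)

lemma lift_0: "lift k T t e 0 = pt (T 0) k"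
  by (simp add: lift_def offset_def zero_f4_def)

lemma lift_in_cube4: "T \<in> L \<Longrightarrow> lift k T t e \<in> cube4 L"
  by (cases t; cases e; cases k) (simp_all add: cube4_def lift_def offset_def f4_arith)

lemma lift_base_layer_place:
  assumes "T \<in> cube4 L" "T 0 = pt x k"
  shows "lift k (base T) (layer T) (place T) = T"
proof
  fix j
  have "lo (T F0) = k" "hi (T F0) = x" using assms(2) by (simp_all add: zero_f4_def)
  moreover have "lo (T F0) + lo (T F1) + lo (T Fw) + lo (T Fv) = 0"
    using assms(1) by (simp add: cube4_def)
  ultimately have "j * place T + offset k (layer T) j = lo (T j)"
    unfolding place_def layer_def
    by (cases j; cases "lo (T F1)"; cases "lo (T Fw)"; cases "lo (T Fv)"; cases k)
       (simp_all add: offset_def f4_arith)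
  then show "lift k (base T) (layer T) (place T) j = T j"
    by (simp add: lift_def base_def)
qed

definition solve_place :: "f4 \<Rightarrow> f4 \<Rightarrow> f4 \<Rightarrow> f4 \<Rightarrow> f4" where
  "solve_place k t j a = (a + offset k t j) / j"

lemma solve_place_iff: "j \<noteq> 0 \<Longrightarrow> j * e + offset k t j = a \<longleftrightarrow> e = solve_place k t j a"
  unfolding solve_place_def by (auto simp: f4_add_eq nonzero_eq_divide_eq add_ac mult_ac)

lemma lift_through:
  assumes "T \<in> through L x j c" "j \<noteq> 0"
  shows "lift k T t (solve_place k t j a) \<in> through (cube4 L) (pt x k) j (pt c a)"
  using assms solve_place_iff[OF assms(2)] 
  by (auto simp: through_def lift_in_cube4 lift_0) (auto simp: lift_def)

lemma through_cube4:
  assumes "T \<in> through (cube4 L) (pt x k) j (pt c a)" "j \<noteq> 0"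
  shows "base T \<in> through L x j c" "T = lift k (base T) (layer T) (solve_place k (layer T) j a)"
proof -
  show "base T \<in> through L x j c"
    using assms by (auto simp: through_def cube4_def base_def)
  have T: "lift k (base T) (layer T) (place T) = T"
    using assms by (intro lift_base_layer_place) (auto simp: through_def)
  have "T j = pt c a" using assms by (auto simp: through_def)
  with T have "j * place T + offset k (layer T) j = a"
    by (metis lift_def lo_pt)
  then show "T = lift k (base T) (layer T) (solve_place k (layer T) j a)"
    using T assms(2) solve_place_iff by metis
qed

text \<open>
  A layer is broken into the cosets of \<open>{0, m}\<close>. Adding \<open>m\<close> to \<open>e\<close> adds \<open>j * m\<close> to the copy on level
  \<open>j\<close>, so on level \<open>j\<close> either half consists of the ends of one edge, of the new colour \<open>j * m\<close>; on the
  three levels these colours differ. \<open>mate\<close> tells the two triples of a half apart.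
\<close>
definition half :: "f4 \<Rightarrow> f4 \<Rightarrow> bool" where "half m e \<longleftrightarrow> e = 0 \<or> e = m"
definition mate :: "f4 \<Rightarrow> f4 \<Rightarrow> bool" where "mate m e \<longleftrightarrow> e = 0 \<or> e = Fw * m"

lemma half_add: "half m (e + m) = half m e"
  unfolding half_def by (cases m; cases e) (simp_all add: f4_arith)

lemma half_mate: "m \<noteq> 0 \<Longrightarrow> \<exists>e. half m e = x \<and> mate m e = y"
  unfolding ex_f4 by (cases m; cases x; cases y) (simp_all add: half_def mate_def f4_arith)

definition lift_mark :: "((f4 \<Rightarrow> nat) \<Rightarrow> f4 \<Rightarrow> layer_mark) \<Rightarrow> (f4 \<Rightarrow> nat) \<Rightarrow> mark" where
  "lift_mark F T = (case F (base T) (layer T) of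
     LPure p \<Rightarrow> Pure p
   | LMixed r \<Rightarrow> Mixed r
   | Split m r s \<Rightarrow> Chosen (if half m (place T) then r else s) m (mate m (place T)))"

text \<open>
  An edge between copies \<open>a\<close> and \<open>b\<close> of one point on level \<open>j\<close> has the new colour \<open>a + b = j * m\<close>. This
  determines \<open>m\<close>, and with it the layer of this kind that is broken at the point; the edge covers the
  points of one half and goes to the class that keeps the other half.
\<close>
definition lift_edge ::
  "(f4 \<Rightarrow> nat) set \<Rightarrow> nat \<Rightarrow> f4 \<Rightarrow> ((f4 \<Rightarrow> nat) \<Rightarrow> f4 \<Rightarrow> layer_mark)
     \<Rightarrow> (f4 \<Rightarrow> nat \<Rightarrow> nat \<Rightarrow> f4 \<Rightarrow> f4 \<Rightarrow> nat) \<Rightarrow> f4 \<Rightarrow> nat \<Rightarrow> nat \<Rightarrow> nat" where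
  "lift_edge L x k F G j y z =
     (if hi y \<noteq> hi z then G j (hi y) (hi z) (lo y) (lo z)
      else let m = (lo y + lo z) / j;
               (T, t) = (THE u. fst u \<in> through L x j (hi y) \<and>
                  (\<exists>r s. F (fst u) (snd u) = Split m r s))
           in case F T t of Split m' r s \<Rightarrow>
                if half m (solve_place k t j (lo y)) then s else r)"

text \<open>
  The colours \<open>pt 0 \<delta>\<close> are the new ones; all other colours have the form \<open>pt (Suc i) 0\<close>.
\<close>
definition lift_colour :: "(nat \<Rightarrow> nat \<Rightarrow> f4 \<Rightarrow> f4 \<Rightarrow> nat) \<Rightarrow> nat \<Rightarrow> nat \<Rightarrow> nat" where
  "lift_colour col y z =
     (if hi y = hi z then pt 0 (lo y + lo z) else pt (Suc (col (hi y) (hi z) (lo y) (lo z))) 0)"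

lemma one_factorization_lift_colour:
  assumes "layered_factorization v col"
  shows "one_factorization (4 * v) (lift_colour col)"
proof -
  interpret layered_factorization v col by fact
  show ?thesis
  proof
    fix y z show "lift_colour col y z = lift_colour col z y"
      by (auto simp: lift_colour_def col_sym add.commute)
  next
    fix y z z' assume lt: "y < 4 * v" "z < 4 * v" "z' < 4 * v" and ne: "z \<noteq> y" "z' \<noteq> y"
      and eq: "lift_colour col y z = lift_colour col y z'"
    show "z = z'"
    proof (cases "hi y = hi z")
      case True
      then have "hi y = hi z'" "lo y + lo z = lo y + lo z'"
        using eq by (auto simp: lift_colour_def split: if_splits)
      then show ?thesis using True by (metis add_left_imp_eq pt_hi_lo)
    next
      case False
      then have "hi y \<noteq> hi z'" "col (hi y) (hi z) (lo y) (lo z) = col (hi y) (hi z') (lo y) (lo z')"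
        using eq by (auto simp: lift_colour_def split: if_splits)
      then have "hi z = hi z' \<and> lo z = lo z'"
        using False lt by (intro col_inj[of "hi y"]) auto
      then show ?thesis by (metis pt_hi_lo)
    qed
  next
    fix x y z assume lt: "x < 4 * v" "y < 4 * v" "z < 4 * v" and ne: "y \<noteq> z"
    show "\<exists>u<4 * v. u \<noteq> x \<and> lift_colour col x u = lift_colour col y z"
    proof (cases "hi y = hi z")
      case True
      with ne have d: "lo y + lo z \<noteq> 0" by (metis f4_add_eq_0 pt_hi_lo)
      show ?thesis using True lt d
        by (intro exI[of _ "pt (hi x) (lo x + (lo y + lo z))"])
           (auto simp: lift_colour_def, metis f4_add_eq_0 lo_pt add.commute f4_add_self')
    next
      case False
      with lt col_everywhere[of "hi x" "hi y" "hi z" "lo x" "lo y" "lo z"] obtain u b where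
        "u < v" "u \<noteq> hi x" "col (hi x) u (lo x) b = col (hi y) (hi z) (lo y) (lo z)" by auto
      then show ?thesis using False
        by (intro exI[of _ "pt u b"]) (auto simp: lift_colour_def)
    qed
  qed
qed

lemma (in layered_gadget) gadget_lift:
  assumes L: "cube v L"
  shows "gadget (4 * v) (cube4 L) (lift_colour col) (pt x k) P R (lift_mark F) (lift_edge L x k F G)"
proof -
  let ?g = "lift_edge L x k F G"
  have edge: "?g j (pt c a) (pt c b) = (if half m (solve_place k t j a) then s else r)"
    if "a \<noteq> b" "j \<noteq> 0" "c < v" "T \<in> through L x j c" "F T t = Split m r s" "a + b = j * m"
    for j c a b T t m r s
  proof -
    have m: "m = (a + b) / j" using that by (simp add: nonzero_eq_divide_eq mult.commute)
    then have "m \<noteq> 0" using that by auto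
    from split_unique[OF this that(2,3)] have
      "(THE u. fst u \<in> through L x j c \<and> (\<exists>r s. F (fst u) (snd u) = Split m r s)) = (T, t)"
      by (rule the1_equality) (use that in auto)
    then show ?thesis using that by (simp add: lift_edge_def Let_def m [symmetric])
  qed
  have gsym: "?g j y z = ?g j z y" for j y z
  proof (cases "hi y = hi z")
    case False
    then show ?thesis by (simp add: lift_edge_def G_sym[of "hi y" "hi z"])
  next
    case True
    have "half ((lo y + lo z) / j) (solve_place k t j (lo y)) =
          half ((lo y + lo z) / j) (solve_place k t j (lo z))" for t
    proof -
      have "solve_place k t j (lo y) = solve_place k t j (lo z) + (lo y + lo z) / j"
        by (simp add: solve_place_def add_divide_distrib[symmetric] add_ac)
      then show ?thesis by (simp add: half_add)
    qed
    then show ?thesis using True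
      by (simp add: lift_edge_def Let_def add.commute[of "lo z"] cong: layer_mark.case_cong)
  qed
  show ?thesis
  proof (unfold_locales)
    fix p j y assume p: "p \<in> P" "j \<noteq> (0::f4)" "y < 4 * v"
    obtain c a where y: "y = pt c a" by (rule pt_exhaust)
    from p y pure[of p j c] obtain T t where T: "T \<in> through L x j c" "F T t = LPure p" by auto
    show "\<exists>T\<in>through (cube4 L) (pt x k) j y. lift_mark F T = Pure p"
      using lift_through[OF T(1) p(2), of k t a] T(2) y
      by (intro bexI) (auto simp: lift_mark_def)
  next
    fix r j y assume r: "r \<in> R" "j \<noteq> (0::f4)" "y < 4 * v"
    obtain c a where y: "y = pt c a" by (rule pt_exhaust)
    with r have c: "c < v" by simp
    from mixed[OF r(1,2) c] consider
      (mixed) T t where "T \<in> through L x j c" "F T t = LMixed r"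
      | (split) T t m r' s' where "T \<in> through L x j c" "m \<noteq> 0" "F T t = Split m r' s'"
           "r = r' \<or> r = s'"
      | (edge) d b where "d < v" "d \<noteq> c" "G j c d a b = r"
      by metis
    then show "(\<exists>T\<in>through (cube4 L) (pt x k) j y. lift_mark F T = Mixed r \<or>
          (\<exists>m h. m \<noteq> 0 \<and> lift_mark F T = Chosen r m h)) \<or>
        (\<exists>z<4 * v. z \<noteq> y \<and> ?g j y z = r)"
    proof cases
      case mixed
      show ?thesis using lift_through[OF mixed(1) r(2), of k t a] mixed(2) y
        by (intro disjI1 bexI) (auto simp: lift_mark_def)
    next
      case split
      let ?e = "solve_place k t j a"
      let ?T = "lift k T t ?e"
      have T: "?T \<in> through (cube4 L) (pt x k) j y"
        using lift_through[OF split(1) r(2)] y by simp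
      have m: "lift_mark F ?T = Chosen (if half m ?e then r' else s') m (mate m ?e)"
        using split by (simp add: lift_mark_def)
      \<comment> \<open>If \<open>r\<close> does not keep the half at this point, it has the edge between the ends of this half.\<close>
      have e: "?g j y (pt c (a + j * m)) = (if half m ?e then s' else r')"
        unfolding y using split(1-3) r(2) c by (intro edge) auto
      have "pt c (a + j * m) < 4 * v \<and> pt c (a + j * m) \<noteq> y"
        using c y split(2) r(2) by simp
      then show ?thesis using T m e split(2,4) by metis
    next
      case edge
      then show ?thesis using y by (intro disjI2 exI[of _ "pt d b"]) (auto simp: lift_edge_def)
    qed
  next
    fix r y assume r: "r \<in> R" "y < 4 * v" "y \<noteq> pt x k"
    obtain y' b where y: "y = pt y' b" by (rule pt_exhaust)
    show "\<exists>j c d. j \<noteq> 0 \<and> c < 4 * v \<and> d < 4 * v \<and> c \<noteq> d \<and>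
        lift_colour col c d = lift_colour col (pt x k) y \<and> ?g j c d = r"
    proof (cases "y' = x")
      case False
      with r y rainbow[of r y' k b] obtain j c d a' b' where
        *: "j \<noteq> 0" "c < v" "d < v" "c \<noteq> d" "col c d a' b' = col x y' k b" "G j c d a' b' = r"
        by auto
      then show ?thesis using y False
        by (intro exI[of _ j] exI[of _ "pt c a'"] exI[of _ "pt d b'"])
           (auto simp: lift_colour_def lift_edge_def)
    next
      case True
      define \<delta> where "\<delta> = k + b"
      have \<delta>: "\<delta> \<noteq> 0" using True r y by (auto simp: \<delta>_def)
      from split[OF r(1)] obtain T t m r' s where
        T: "T \<in> L" "T 0 = x" "m \<noteq> 0" "F T t = Split m r' s" "r' = r \<or> s = r" by metis
      \<comment> \<open>The edge of the new colour \<open>\<delta>\<close> lies on the level where the halves differ by \<open>\<delta>\<close>.\<close>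
      define j where "j = \<delta> / m"
      have j: "j \<noteq> 0" "j * m = \<delta>" using T \<delta> by (auto simp: j_def)
      obtain e where e: "half m e \<longleftrightarrow> r' \<noteq> r" using half_mate[OF T(3)] by blast
      define a where "a = j * e + offset k t j"
      have e': "solve_place k t j a = e" using solve_place_iff[OF j(1)] a_def by metis
      have "T j < v" using cube.less[OF L T(1)] .
      moreover have "?g j (pt (T j) a) (pt (T j) (a + \<delta>)) = r"
        using edge[of a "a + \<delta>" j "T j" T t m r' s] T j \<delta> e e' \<open>T j < v\<close>
        by (auto simp: through_def)
      ultimately show ?thesis using j \<delta> y True
        by (intro exI[of _ j] exI[of _ "pt (T j) a"] exI[of _ "pt (T j) (a + \<delta>)"])
           (auto simp: lift_colour_def \<delta>_def)
    qed
  next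
    fix r h assume "r \<in> R"
    from split[OF this] obtain T t m r' s where
      T: "T \<in> L" "T 0 = x" "m \<noteq> 0" "F T t = Split m r' s" "r' = r \<or> s = r" by metis
    obtain e where "half m e \<longleftrightarrow> r' = r" "mate m e = h" using half_mate[OF T(3)] by blast
    then show "\<exists>T\<in>cube4 L. T 0 = pt x k \<and> (\<exists>m. m \<noteq> 0 \<and> lift_mark F T = Chosen r m h)"
      using T by (intro bexI[of _ "lift k T t e"]) (auto simp: lift_0 lift_mark_def lift_in_cube4)
  next
    fix m j y assume m: "m \<noteq> (0::f4)" "j \<noteq> (0::f4)" "y < 4 * v"
    obtain c a where y: "y = pt c a" by (rule pt_exhaust)
    with m have c: "c < v" by simp
    from split_unique[OF m(1,2) c] obtain T t r s where
      T: "T \<in> through L x j c" "F T t = Split m r s" by auto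
    show "\<exists>!T. T \<in> through (cube4 L) (pt x k) j y \<and> (\<exists>r h. lift_mark F T = Chosen r m h)"
    proof (rule ex1I[of _ "lift k T t (solve_place k t j a)"])
      show "lift k T t (solve_place k t j a) \<in> through (cube4 L) (pt x k) j y \<and>
        (\<exists>r h. lift_mark F (lift k T t (solve_place k t j a)) = Chosen r m h)"
        using lift_through[OF T(1) m(2)] T y by (auto simp: lift_mark_def)
    next
      fix T' assume T': "T' \<in> through (cube4 L) (pt x k) j y \<and>
        (\<exists>r h. lift_mark F T' = Chosen r m h)"
      then obtain r' s' where F': "F (base T') (layer T') = Split m r' s'"
        by (auto simp: lift_mark_def split: layer_mark.splits)
      have b: "base T' \<in> through L x j c"
          "T' = lift k (base T') (layer T') (solve_place k (layer T') j a)"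
        using through_cube4 T' y m by blast+
      have "(base T', layer T') = (T, t)"
        using split_unique[OF m(1,2) c] F' b(1) T by (metis fst_conv snd_conv)
      then show "T' = lift k T t (solve_place k t j a)" using b(2) by simp
    qed
  qed (use finite_P finite_R card_P card_R gsym in auto)
qed

lemma has_gadgets_lift:
  assumes "has_layered_gadgets v"
  shows "has_gadgets (4 * v)"
proof -
  obtain L col where L: "cube v L" "layered_factorization v col"
    "\<forall>x<v. \<exists>P R F G. layered_gadget v L col x P R F G"
    using assms by (auto simp: has_layered_gadgets_def)
  have "\<exists>P R f g. gadget (4 * v) (cube4 L) (lift_colour col) x P R f g" if "x < 4 * v" for x
    using L(3) that layered_gadget.gadget_lift[OF _ L(1), of col "hi x" _ _ _ _ "lo x"] by (metis hi_less_iff pt_hi_lo)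
  then show ?thesis
    using cube4[OF L(1)] one_factorization_lift_colour[OF L(2)] by (auto simp: has_gadgets_def)
qed

section \<open>From a gadget to a layered gadget\<close>

text \<open>
  A mixed class \<open>r\<close> lifts to the classes \<open>pt r t\<close>. They form two pairs: the first chosen triple of
  \<open>r\<close> repairs the classes \<open>t = part False b\<close> and the second one the classes \<open>t = part True b\<close>.
\<close>
definition part :: "bool \<Rightarrow> bool \<Rightarrow> f4" where
  "part h b = (if h then if b then Fv else Fw else if b then F1 else F0)"

lemma part_cases: obtains h b where "t = part h b"
proof (cases t)
  case F0 then show ?thesis using that[of False False] by (simp add: part_def)
next
  case F1 then show ?thesis using that[of False True] by (simp add: part_def)
next
  case Fw then show ?thesis using that[of True False] by (simp add: part_def)
next
  case Fv then show ?thesis using that[of True True] by (simp add: part_def)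
qed

lemma part_eq_iff [simp]: "part h b = part h' b' \<longleftrightarrow> h = h' \<and> b = b'"
  by (auto simp: part_def)

text \<open>
  Over an ordinary triple, layer \<open>t\<close> goes to the lifted class number \<open>t\<close>. A chosen triple has the same
  layers, but it is not complete in the two classes that it repairs: the layer \<open>part h False\<close> is
  broken and shared by them, and the layer \<open>part h True\<close> is left over and goes to the new pure class
  \<open>pt 0 m\<close>.
\<close>
definition layer_marks :: "((f4 \<Rightarrow> nat) \<Rightarrow> mark) \<Rightarrow> (f4 \<Rightarrow> nat) \<Rightarrow> f4 \<Rightarrow> layer_mark" where
  "layer_marks f T t = (case f T of
     Pure p \<Rightarrow> LPure (pt (Suc p) t)
   | Mixed r \<Rightarrow> LMixed (pt r t)
   | Chosen r m h \<Rightarrow>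
       if t = part h False then Split m (pt r (part h False)) (pt r (part h True))
       else if t = part h True then LPure (pt 0 m)
       else LMixed (pt r t))"

text \<open>
  The lifts of an edge: for fixed \<open>t\<close>, the pairs of copies with \<open>orient c d a b = t\<close> form a perfect
  matching on which \<open>a + b\<close> takes every value once, since \<open>Fw \<noteq> 1\<close>. The order of the end points has to
  enter, for a function symmetric in \<open>a\<close> and \<open>b\<close> would take the value \<open>t\<close> an even number of times at
  \<open>a = b\<close>, whereas \<open>a + b = 0\<close> has to occur once.
\<close>
definition orient :: "nat \<Rightarrow> nat \<Rightarrow> f4 \<Rightarrow> f4 \<Rightarrow> f4" where
  "orient c d a b = (if c < d then a + Fw * b else b + Fw * a)"

lemma orient_sym: "c \<noteq> d \<Longrightarrow> orient c d a b = orient d c b a"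
  by (auto simp: orient_def)

lemma orient_solvable: "\<exists>b. orient c d a b = t"
  unfolding orient_def ex_f4 by (cases a; cases t) (simp_all add: f4_arith)

lemma orient_orthogonal: "\<exists>a b. orient c d a b = t \<and> a + b = k"
  unfolding orient_def ex_f4 by (cases k; cases t) (simp_all add: f4_arith)

lemma card_pt: "card (case_prod pt ` (A \<times> UNIV)) = 4 * card A"
proof -
  have "inj_on (case_prod pt) (A \<times> UNIV)" by (auto simp: inj_on_def)
  then show ?thesis by (simp add: card_image card_cartesian_product card_f4)
qed

lemma layered_factorization_expand:
  assumes "one_factorization v col"
  shows "layered_factorization v (\<lambda>c d a b. pt (col c d) (a + b))"
proof -
  interpret one_factorization v col by fact
  show ?thesis
  proof (unfold_locales, goal_cases)
    case (1 c d a b)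
    show ?case by (rule arg_cong2[where f = pt, OF col_sym add.commute])
  next
    case (2 c d e a b b')
    then show ?case using col_inj[of c d e] by simp
  next
    case (3 x c d a' a b)
    then obtain y where "y < v" "y \<noteq> x" "col x y = col c d" using col_everywhere by blast
    then show ?case by (intro exI[of _ y] conjI exI[of _ "a' + (a + b)"]) auto
  qed
qed

text \<open>
  The pure classes are four lifts of every old one, which are numbered from \<open>pt 1 0\<close> on, and the three
  classes \<open>pt 0 m\<close> made of the layers left over.
\<close>
lemma (in gadget) layered_gadget_expand:
  "layered_gadget v L (\<lambda>c d a b. pt (col c d) (a + b)) x
     (case_prod pt ` (Suc ` P \<times> UNIV) \<union> pt 0 ` (UNIV - {0})) (case_prod pt ` (R \<times> UNIV))
     (layer_marks f) (\<lambda>j c d a b. pt (g j c d) (orient c d a b))"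
    (is "layered_gadget v L ?col x ?P ?R ?F ?G")
proof
  show "finite ?P" "finite ?R" using finite_P finite_R by simp_all
  have "card ?P = 4 * card P + 3"
    by (subst card_Un_disjoint)
       (auto simp: finite_P card_pt card_image inj_on_def card_Diff_singleton card_f4)
  then show "2 * card ?P + 2 = 4 * v" using card_P by simp
  show "2 * card ?R = 3 * (4 * v)" using card_R by (simp add: card_pt)
next
  fix c d j a b assume "c \<noteq> (d::nat)"
  then show "?G j c d a b = ?G j d c b a"
    by (intro arg_cong2[where f = pt] g_sym orient_sym)
next
  fix p j c assume p: "p \<in> ?P" and jc: "j \<noteq> (0::f4)" "c < v"
  from p consider q t where "q \<in> P" "p = pt (Suc q) t" | m where "m \<noteq> 0" "p = pt 0 m" by auto
  then show "\<exists>T\<in>through L x j c. \<exists>t. ?F T t = LPure p"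
  proof cases
    case 1
    from pure[OF 1(1) jc] obtain T where "T \<in> through L x j c" "f T = Pure q" by blast
    then show ?thesis using 1 by (intro bexI[of _ T] exI[of _ t]) (auto simp: layer_marks_def)
  next
    case 2
    with chosen_unique[OF 2(1) jc] obtain T r h where
      "T \<in> through L x j c" "f T = Chosen r m h" by auto
    then show ?thesis using 2
      by (intro bexI[of _ T] exI[of _ "part h True"]) (auto simp: layer_marks_def)
  qed
next
  fix r' j c assume "r' \<in> ?R" and jc: "j \<noteq> (0::f4)" "c < v"
  then obtain r t where r: "r \<in> R" "r' = pt r t" by auto
  from mixed[OF r(1) jc] consider
    (mixed) T where "T \<in> through L x j c" "f T = Mixed r"
    | (chosen) T m h where "T \<in> through L x j c" "m \<noteq> 0" "f T = Chosen r m h"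
    | (edge) d where "d < v" "d \<noteq> c" "g j c d = r" by blast
  then show "(\<exists>T\<in>through L x j c. \<exists>t. ?F T t = LMixed r') \<or>
      (\<exists>T\<in>through L x j c. \<exists>t m s. m \<noteq> 0 \<and> (?F T t = Split m r' s \<or> ?F T t = Split m s r')) \<or>
      (\<exists>d<v. d \<noteq> c \<and> (\<forall>a. \<exists>b. ?G j c d a b = r'))"
  proof cases
    case mixed
    then show ?thesis using r by (intro disjI1 bexI[of _ T] exI[of _ t]) (auto simp: layer_marks_def)
  next
    case chosen
    obtain h' b where t: "t = part h' b" by (rule part_cases)
    show ?thesis
    proof (cases "h' = h")
      case True
      have "?F T (part h False) = Split m (pt r (part h False)) (pt r (part h True))"
        using chosen by (simp add: layer_marks_def)
      then have "\<exists>s. ?F T (part h False) = Split m r' s \<or> ?F T (part h False) = Split m s r'"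
        using True t r by (cases b) auto
      then show ?thesis using chosen by blast
    next
      case False
      then have "?F T t = LMixed r'" using chosen t r by (simp add: layer_marks_def)
      then show ?thesis using chosen by blast
    qed
  next
    case edge
    then show ?thesis using r by (intro disjI2 exI[of _ d]) (simp add: orient_solvable)
  qed
next
  fix r' y a b assume "r' \<in> ?R" and y: "y < v" "y \<noteq> x"
  then obtain r t where r: "r \<in> R" "r' = pt r t" by auto
  from rainbow[OF r(1) y] obtain j c d where
    *: "j \<noteq> 0" "c < v" "d < v" "c \<noteq> d" "col c d = col x y" "g j c d = r" by blast
  obtain a' b' where "orient c d a' b' = t" "a' + b' = a + b" using orient_orthogonal by blast
  then show "\<exists>j c d a' b'. j \<noteq> 0 \<and> c < v \<and> d < v \<and> c \<noteq> d \<and>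
        ?col c d a' b' = ?col x y a b \<and> ?G j c d a' b' = r'"
    using * r by (intro exI[of _ j] exI[of _ c] exI[of _ d] exI[of _ a'] exI[of _ b']) simp
next
  fix r' assume "r' \<in> ?R"
  then obtain r t where r: "r \<in> R" "r' = pt r t" by auto
  obtain h b where t: "t = part h b" by (rule part_cases)
  from chosen[OF r(1)] obtain T m where T: "T \<in> L" "T 0 = x" "m \<noteq> 0" "f T = Chosen r m h" by blast
  then have "?F T (part h False) = Split m (pt r (part h False)) (pt r (part h True))"
    by (simp add: layer_marks_def)
  then have "\<exists>s. ?F T (part h False) = Split m r' s \<or> ?F T (part h False) = Split m s r'"
    using r t by (cases b) auto
  then show "\<exists>T\<in>L. T 0 = x \<and>
      (\<exists>t m s. m \<noteq> 0 \<and> (?F T t = Split m r' s \<or> ?F T t = Split m s r'))"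
    using T by blast
next
  fix m j c assume m: "m \<noteq> (0::f4)" "j \<noteq> (0::f4)" "c < v"
  have split: "(\<exists>r s. ?F T t = Split m r s) \<longleftrightarrow> (\<exists>r h. f T = Chosen r m h \<and> t = part h False)" for T t
    by (auto simp: layer_marks_def split: mark.splits)
  from chosen_unique[OF m] obtain T r h where
    T: "T \<in> through L x j c" "f T = Chosen r m h"
    and uniq: "\<And>T'. T' \<in> through L x j c \<Longrightarrow> \<exists>r h. f T' = Chosen r m h \<Longrightarrow> T' = T" by blast
  show "\<exists>!z. fst z \<in> through L x j c \<and> (\<exists>r s. ?F (fst z) (snd z) = Split m r s)"
    unfolding split
  proof (rule ex1I[of _ "(T, part h False)"])
    fix z assume "fst z \<in> through L x j c \<and>
      (\<exists>r h. f (fst z) = Chosen r m h \<and> snd z = part h False)"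
    then show "z = (T, part h False)" using uniq[of "fst z"] T(2) by (cases z) auto
  qed (use T in auto)
qed

lemma has_layered_gadgets_expand:
  assumes "has_gadgets v"
  shows "has_layered_gadgets v"
  using assms unfolding has_gadgets_def has_layered_gadgets_def
  by (meson gadget.layered_gadget_expand layered_factorization_expand)

section \<open>A layered gadget on seven points\<close>

definition cube7 :: "(f4 \<Rightarrow> nat) set" where
  "cube7 = {T. (\<forall>j. T j < 7) \<and> (T F0 + T F1 + T Fw + T Fv) mod 7 = 0}"

lemma cube_cube7: "cube 7 cube7"
proof (unfold_locales, goal_cases)
  case (1 T j)
  then show ?case by (simp add: cube7_def)
next
  case (2 T k)
  have "T (F0 + k) + T (F1 + k) + T (Fw + k) + T (Fv + k) = T F0 + T F1 + T Fw + T Fv"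
    by (cases k) (simp_all only: plus_f4.simps add_ac)
  with 2 show ?case by (simp add: cube7_def)
next
  case (3 S j)
  define s where "s = S F0 + S F1 + S Fw + S Fv - S j"
  \<comment> \<open>The factor 6 is \<open>- 1\<close> modulo 7.\<close>
  define T where "T = S(j := (6 * s) mod 7)"
  have "T F0 + T F1 + T Fw + T Fv = s + (6 * s) mod 7"
    by (cases j) (simp_all add: T_def s_def)
  also have "\<dots> mod 7 = 0" by (simp add: mod_simps)
  finally have "T \<in> cube7" using 3 by (simp add: cube7_def T_def)
  then show ?case by (intro bexI[of _ T]) (simp_all add: T_def)
next
  case (4 T T' j)
  have lt: "T j < 7" "T' j < 7" using 4 by (simp_all add: cube7_def)
  have eq: "T i = T' i" if "i \<noteq> j" for i using 4(3) that by simp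
  define s where "s = T F0 + T F1 + T Fw + T Fv - T j"
  have "T F0 + T F1 + T Fw + T Fv = s + T j" by (cases j) (simp_all add: s_def)
  moreover have "T' F0 + T' F1 + T' Fw + T' Fv = s + T' j"
    using eq by (cases j) (simp_all add: s_def)
  ultimately have "(s + T j) mod 7 = 0" "(s + T' j) mod 7 = 0"
    using 4(1,2) unfolding cube7_def by simp_all
  then have "T j = T' j" using lt by presburger
  then show ?case using eq by (metis ext)
qed

definition gap7 :: "nat \<Rightarrow> nat \<Rightarrow> nat" where "gap7 c d = (d + 7 - c) mod 7"

text \<open>
  Joining every residue to those at distance \<open>s\<close> gives a cycle of length seven for each
  \<open>s = 1, 2, 3\<close>. The function colours the vertices of the cycle through the edge \<open>{c, d}\<close> properly
  with the three nonzero field elements and returns the colour of \<open>c\<close>. The factors 1, 4, 5 are the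
  inverses of 1, 2, 3 modulo 7, which turn \<open>c\<close> into its position on the cycle.
\<close>
definition hue :: "nat \<Rightarrow> nat \<Rightarrow> f4" where
  "hue c d = [F1, Fw, F1, Fw, F1, Fw, Fv] ! (c * [0, 1, 4, 5, 5, 4, 1] ! gap7 c d mod 7)"

lemma hue_checked:
  "\<forall>c\<in>set [0..<7]. \<forall>d\<in>set [0..<7]. c \<noteq> d \<longrightarrow> hue c d \<noteq> F0 \<and> hue c d \<noteq> hue d c"
  by code_simp

lemma hue_gap_checked:
  "\<forall>c\<in>set [0..<7]. \<forall>d\<in>set [0..<7]. \<forall>e\<in>set [0..<7]. gap7 c d = gap7 e c \<longrightarrow> hue c d = hue c e"
  by code_simp

lemma hue_nonzero: "c < 7 \<Longrightarrow> d < 7 \<Longrightarrow> c \<noteq> d \<Longrightarrow> hue c d \<noteq> 0"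
  and hue_proper: "c < 7 \<Longrightarrow> d < 7 \<Longrightarrow> c \<noteq> d \<Longrightarrow> hue c d \<noteq> hue d c"
  using hue_checked by (simp_all add: zero_f4_def)

lemma hue_gap: "c < 7 \<Longrightarrow> d < 7 \<Longrightarrow> e < 7 \<Longrightarrow> gap7 c d = gap7 e c \<Longrightarrow> hue c d = hue c e"
  using hue_gap_checked by simp

lemma gap7_if: "c < 7 \<Longrightarrow> d < 7 \<Longrightarrow> gap7 c d = (if c \<le> d then d - c else d + 7 - c)"
proof -
  assume cd: "c < 7" "d < 7"
  show ?thesis
  proof (cases "c \<le> d")
    case True
    then have "d + 7 - c = (d - c) + 7" by simp
    then have "(d + 7 - c) mod 7 = (d - c) mod 7" by (simp only: mod_add_self2)
    also have "\<dots> = d - c" using cd by (intro mod_less) simp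
    finally show ?thesis using True by (simp add: gap7_def)
  qed (use cd in \<open>simp add: gap7_def\<close>)
qed

lemma gap7_lt: "gap7 c d < 7" by (simp add: gap7_def)

lemma gap7_eq_0: "c < 7 \<Longrightarrow> d < 7 \<Longrightarrow> gap7 c d = 0 \<longleftrightarrow> c = d"
  by (auto simp: gap7_if)

lemma gap7_inj: "c < 7 \<Longrightarrow> d < 7 \<Longrightarrow> e < 7 \<Longrightarrow> gap7 c d = gap7 c e \<Longrightarrow> d = e"
  by (auto simp: gap7_if split: if_splits)

lemma gap7_inj': "c < 7 \<Longrightarrow> d < 7 \<Longrightarrow> e < 7 \<Longrightarrow> gap7 d c = gap7 e c \<Longrightarrow> d = e"
  by (auto simp: gap7_if split: if_splits)

lemma gap7_forward: "c < 7 \<Longrightarrow> s < 7 \<Longrightarrow> gap7 c ((c + s) mod 7) = s"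
  by (cases "c + s < 7") (auto simp: gap7_if mod_if)

lemma gap7_backward: "c < 7 \<Longrightarrow> s < 7 \<Longrightarrow> gap7 ((c + 7 - s) mod 7) c = s"
  by (cases "c < s") (auto simp: gap7_if mod_if)

text \<open>
  For \<open>d = c + s\<close> modulo 7, with \<open>s\<close> any nonzero residue, there are two perfect matchings from the
  copies of \<open>c\<close> to those of \<open>d\<close>, numbered by \<open>i = 0, 1\<close>. They join, for every \<open>k\<close>,
  \<open>a = hue c d * k + i\<close> to \<open>b = hue d c * k + Fw + i\<close>, and such an edge gets the colour \<open>(s, k)\<close>. At
  \<open>c\<close> the edges of this colour towards \<open>c + s\<close> use the copies \<open>hue c d * k + {0, 1}\<close> and those towards
  \<open>c - s\<close> the copies \<open>hue c d * k + {Fw, Fv}\<close>, which makes the colour class a perfect matching. The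
  edges between the copies of \<open>c\<close> and \<open>d\<close> are shared by \<open>s\<close> and \<open>- s\<close>, and \<open>k\<close> is recovered from
  \<open>a + b = (hue c d + hue d c) * k + Fw\<close>; this is where adjacent vertices need different hues.
\<close>
definition slope :: "nat \<Rightarrow> nat \<Rightarrow> f4 \<Rightarrow> f4 \<Rightarrow> f4" where
  "slope c d a b = (a + b + Fw) / (hue c d + hue d c)"

text \<open>
  Whether the edge belongs to the arc from \<open>c\<close> to \<open>d\<close> rather than to the arc from \<open>d\<close> to \<open>c\<close>.
\<close>
definition starts :: "nat \<Rightarrow> nat \<Rightarrow> f4 \<Rightarrow> f4 \<Rightarrow> bool" where
  "starts c d a b \<longleftrightarrow> a + hue c d * slope c d a b \<in> {0, 1}"

definition arc_colour :: "nat \<Rightarrow> nat \<Rightarrow> f4 \<Rightarrow> f4 \<Rightarrow> nat" where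
  "arc_colour c d a b = pt (if starts c d a b then gap7 c d else gap7 d c) (slope c d a b)"

lemma slope_sym: "slope c d a b = slope d c b a"
  by (simp add: slope_def add_ac)

lemma slope_iff:
  assumes "c < 7" "d < 7" "c \<noteq> d"
  shows "slope c d a b = k \<longleftrightarrow> b = a + hue c d * k + hue d c * k + Fw"
proof -
  have "hue c d + hue d c \<noteq> 0" using hue_proper[OF assms] by simp
  then have "slope c d a b = k \<longleftrightarrow> b + (a + Fw) = k * (hue c d + hue d c)"
    unfolding slope_def by (simp add: nonzero_divide_eq_eq add_ac)
  also have "\<dots> \<longleftrightarrow> b = a + hue c d * k + hue d c * k + Fw"
    by (subst f4_add_eq) (simp add: algebra_simps)
  finally show ?thesis .
qed

lemma f4_halves: "(a::f4) + Fw \<in> {0, 1} \<longleftrightarrow> a \<notin> {0, 1}"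
  by (cases a) (simp_all add: f4_arith)

lemma starts_sym:
  assumes "c < 7" "d < 7" "c \<noteq> d"
  shows "starts d c b a \<longleftrightarrow> \<not> starts c d a b"
proof -
  define k where "k = slope c d a b"
  then have b: "b = a + hue c d * k + hue d c * k + Fw" using slope_iff[OF assms] by metis
  have "b + hue d c * k = a + hue c d * k + Fw"
    unfolding b by (simp add: add_ac)
  then show ?thesis
    unfolding starts_def slope_sym[of d c] k_def[symmetric] using f4_halves by metis
qed

text \<open>
  For residues \<open>c \<noteq> d\<close> below 7 the functions of arcs used here are symmetric already; this
  makes them symmetric for all other arguments, too.
\<close>
definition symmetrize :: "(nat \<Rightarrow> nat \<Rightarrow> f4 \<Rightarrow> f4 \<Rightarrow> 'a) \<Rightarrow> nat \<Rightarrow> nat \<Rightarrow> f4 \<Rightarrow> f4 \<Rightarrow> 'a" where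
  "symmetrize h c d a b = (if c < d then h c d a b else h d c b a)"

lemma symmetrize_sym: "c \<noteq> d \<Longrightarrow> symmetrize h c d a b = symmetrize h d c b a"
  by (auto simp: symmetrize_def)

lemma symmetrize_arc_colour:
  "c < 7 \<Longrightarrow> d < 7 \<Longrightarrow> c \<noteq> d \<Longrightarrow> symmetrize arc_colour c d a b = arc_colour c d a b"
  by (auto simp: symmetrize_def arc_colour_def starts_sym[of c d] slope_sym[of d c])

lemma solve_slope:
  assumes "c < 7" "d < 7" "c \<noteq> d"
  obtains b where "slope c d a b = k" "starts c d a b \<longleftrightarrow> a + hue c d * k \<in> {0, 1}"
  using slope_iff[OF assms, of a _ k] unfolding starts_def by metis

lemma layered_factorization_arc_colour: "layered_factorization 7 (symmetrize arc_colour)"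
proof (unfold_locales, goal_cases)
  case (1 c d a b)
  then show ?case by (rule symmetrize_sym)
next
  case (2 c d e a b b')
  define k where "k = slope c d a b"
  have eq: "arc_colour c d a b = arc_colour c e a b'"
    using 2 symmetrize_arc_colour[of c d a b] symmetrize_arc_colour[of c e a b'] by auto
  then have k: "slope c e a b' = k" by (simp add: arc_colour_def k_def)
  have gap: "(if starts c d a b then gap7 c d else gap7 d c)
           = (if starts c e a b' then gap7 c e else gap7 e c)"
    using eq by (simp add: arc_colour_def)
  have "hue c d = hue c e"
    using gap hue_gap[OF 2(1,2,3)] hue_gap[OF 2(1,3,2)] gap7_inj[OF 2(1,2,3)] gap7_inj'[OF 2(1,2,3)]
    by metis
  then have "starts c d a b = starts c e a b'"
    unfolding starts_def k k_def[symmetric] by simp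
  then have "d = e" using gap gap7_inj[OF 2(1,2,3)] gap7_inj'[OF 2(1,2,3)] by metis
  moreover have "b = b'"
    using slope_iff[of c d a b k] slope_iff[of c d a b' k] k k_def \<open>d = e\<close> 2 by simp
  ultimately show ?case by simp
next
  case (3 x c d a' a b)
  define k where "k = slope c d a b"
  obtain s where s: "s < 7" "s \<noteq> 0" "arc_colour c d a b = pt s k"
    using 3 gap7_eq_0[of c d] gap7_eq_0[of d c] gap7_lt
    by (cases "starts c d a b") (auto simp: arc_colour_def k_def)
  define y where "y = (x + s) mod 7"
  define z where "z = (x + 7 - s) mod 7"
  have y: "y < 7" "gap7 x y = s" "y \<noteq> x"
    using gap7_forward[OF 3(1) s(1)] gap7_eq_0[of x x] s(2) 3(1) by (auto simp: y_def)
  have z: "z < 7" "gap7 z x = s" "z \<noteq> x"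
    using gap7_backward[OF 3(1) s(1)] gap7_eq_0[of x x] s(2) 3(1) by (auto simp: z_def)
  have hue: "hue x y = hue x z" using hue_gap[of x y z] y z 3(1) by simp
  have "\<exists>y<7. y \<noteq> x \<and> (\<exists>b'. arc_colour x y a' b' = pt s k)"
  proof (cases "a' + hue x y * k \<in> {0, 1}")
    case True
    obtain b' where "slope x y a' b' = k" "starts x y a' b' \<longleftrightarrow> a' + hue x y * k \<in> {0, 1}"
      by (rule solve_slope[of x y a' k]) (use 3 y in auto)
    then show ?thesis using True y by (intro exI[of _ y]) (auto simp: arc_colour_def)
  next
    case False
    obtain b' where "slope x z a' b' = k" "starts x z a' b' \<longleftrightarrow> a' + hue x z * k \<in> {0, 1}"
      by (rule solve_slope[of x z a' k]) (use 3 z in auto)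
    then show ?thesis using False z hue by (intro exI[of _ z]) (auto simp: arc_colour_def)
  qed
  then show ?case using symmetrize_arc_colour 3 s(3) by metis
qed

text \<open>
  On three copies of the residues modulo 7, numbered \<open>F1\<close>, \<open>Fw\<close>, \<open>Fv\<close>, consider the triples
  \<open>(b, c, d)\<close> with \<open>b + c + d = 0\<close> and the arcs of all nonzero differences. The following class
  partitions the 21 points and contains one arc of each difference: the triples \<open>(0, 1, 6)\<close>,
  \<open>(1, 3, 3)\<close>, \<open>(2, 0, 5)\<close>; the arcs from 3 to 6 and from 4 to 5 on level \<open>F1\<close>; from 5 to 2 and from
  6 to 4 on level \<open>Fw\<close>; and from 1 to 0 and from 2 to 4 on level \<open>Fv\<close>. The translations by multiples
  of \<open>(1, 2, 4)\<close> and the map that doubles every residue while it permutes the levels cyclically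
  generate a group of order 21, which preserves the triples and permutes the differences. Class
  \<open>7 * k + e\<close> is the image of the given one under the \<open>k\<close>-th power of the doubling map followed by the
  \<open>e\<close>-th translation, and \<open>arc_class j n s\<close> is the class with the arc from \<open>n\<close> to \<open>n + s\<close> on level \<open>j\<close>.
\<close>
definition arc_class :: "f4 \<Rightarrow> nat \<Rightarrow> nat \<Rightarrow> nat" where
  "arc_class j n s = (case j of
     F1 \<Rightarrow> let (k, e) = [(0, 3), (2, 1), (0, 4), (1, 3), (1, 5), (2, 4)] ! (s - 1) in 7 * k + (n + e) mod 7
   | Fw \<Rightarrow> let (k, e) = [(2, 3), (1, 3), (2, 5), (0, 1), (0, 4), (1, 4)] ! (s - 1) in 7 * k + (4 * n + e) mod 7
   | Fv \<Rightarrow> let (k, e) = [(1, 1), (0, 3), (1, 4), (2, 3), (2, 4), (0, 5)] ! (s - 1) in 7 * k + (2 * n + e) mod 7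
   | F0 \<Rightarrow> 0)"

text \<open>
  The translations by multiples of \<open>(1, 2, 4)\<close> divide the triples into the orbits of
  \<open>(b, 2 * b + u, 4 * b - u)\<close>. The 21 classes use each orbit with \<open>u = 1, 2, 4\<close> twice and each orbit
  with \<open>u = 3, 5, 6\<close> once. \<open>split_class\<close> gives the class in which the triple is an image of
  \<open>(0, 1, 6)\<close>, and \<open>plain_class\<close> the one in which it is an image of \<open>(1, 3, 3)\<close> or of \<open>(2, 0, 5)\<close>.
\<close>
definition split_class :: "nat \<Rightarrow> nat \<Rightarrow> nat" where
  "split_class u b = (if u = 1 then b else if u = 4 then 7 + (b + 2) mod 7 else 14 + (b + 3) mod 7)"
definition plain_class :: "nat \<Rightarrow> nat \<Rightarrow> nat" where
  "plain_class u b = (if u = 1 then (b + 6) mod 7 else if u = 4 then 7 + (b + 1) mod 7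
     else if u = 2 then 14 + (b + 2) mod 7
     else if u = 3 then (b + 5) mod 7 else if u = 5 then 7 + (b + 4) mod 7 else 14 + b)"

text \<open>
  The parameter \<open>b\<close> of the triple of orbit \<open>u\<close> that contains \<open>n\<close> on level \<open>j\<close>.
\<close>
definition foot :: "f4 \<Rightarrow> nat \<Rightarrow> nat \<Rightarrow> nat" where
  "foot j n u = (case j of F1 \<Rightarrow> n | Fw \<Rightarrow> (4 * (n + 7 - u)) mod 7 | Fv \<Rightarrow> (2 * (n + u)) mod 7 | F0 \<Rightarrow> 0)"

lemma cover_checked:
  "\<forall>j\<in>set [F1, Fw, Fv]. \<forall>n\<in>set [0..<7]. \<forall>q\<in>set [0..<21].
     q \<in> set (map (\<lambda>u. split_class u (foot j n u)) [1, 2, 4]) \<or>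
     q \<in> set (map (\<lambda>u. plain_class u (foot j n u)) [1, 2, 3, 4, 5, 6]) \<or>
     q \<in> set (map (\<lambda>s. arc_class j n s) [1, 2, 3, 4, 5, 6]) \<or>
     q \<in> set (map (\<lambda>s. arc_class j ((n + 7 - s) mod 7) s) [1, 2, 3, 4, 5, 6])"
  by code_simp

lemma rainbow_checked:
  "\<forall>q\<in>set [0..<21]. \<forall>s\<in>set [1, 2, 3, 4, 5, 6]. \<exists>j\<in>set [F1, Fw, Fv]. \<exists>n\<in>set [0..<7]. arc_class j n s = q"
  by code_simp

lemma split_checked: "\<forall>q\<in>set [0..<21]. \<exists>u\<in>set [1, 2, 4]. \<exists>b\<in>set [0..<7]. split_class u b = q"
  by code_simp

text \<open>
  The Latin triples at \<open>x\<close> have sum \<open>- x\<close>; adding \<open>x\<close> on level \<open>Fv\<close> reduces them to those of sum 0.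
\<close>
definition norm7 :: "nat \<Rightarrow> f4 \<Rightarrow> nat \<Rightarrow> nat" where
  "norm7 x j c = (if j = Fv then (c + x) mod 7 else c)"

definition triple7 :: "nat \<Rightarrow> nat \<Rightarrow> nat \<Rightarrow> f4 \<Rightarrow> nat" where
  "triple7 x u b j = (case j of F0 \<Rightarrow> x | F1 \<Rightarrow> b | Fw \<Rightarrow> (2 * b + u) mod 7
     | Fv \<Rightarrow> (4 * b + 14 - u - x) mod 7)"

definition orbit7 :: "(f4 \<Rightarrow> nat) \<Rightarrow> nat" where
  "orbit7 T = (T Fw + 5 * T F1) mod 7"

definition tag :: "nat \<Rightarrow> f4" where
  "tag u = (if u = 1 then F1 else if u = 2 then Fw else Fv)"

definition low_bit :: "f4 \<Rightarrow> nat" where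
  "low_bit t = (if t = F1 \<or> t = Fv then 1 else 0)"

text \<open>
  Every triple is to be used twice, once with the layers \<open>F0\<close> and \<open>F1\<close> and once with \<open>Fw\<close> and \<open>Fv\<close>; the
  orbits are parallel classes and account for the uses that the mixed classes leave open. Every class
  of the group orbit lifts to the two mixed classes \<open>2 * q\<close> and \<open>2 * q + 1\<close>, and a use provides each of
  them with one layer. The images of \<open>(0, 1, 6)\<close> are the chosen triples: one of their layers is broken
  between both lifts and the other is left over. They form the three orbits \<open>u = 1, 2, 4\<close>, whence three
  pure classes 10, 11, 12 besides the ten classes 0 to 9 from the orbits \<open>u = 0, 3, 5, 6\<close>.
\<close>
definition mark_of :: "nat \<Rightarrow> nat \<Rightarrow> f4 \<Rightarrow> layer_mark" where
  "mark_of u b t =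
     (if u = 0 then LPure (code t)
      else if u \<in> {1, 2, 4} then
        (if t = F0 then Split (tag u) (2 * split_class u b) (2 * split_class u b + 1)
         else if t = F1 then LPure (9 + code (tag u))
         else LMixed (2 * plain_class u b + low_bit t))
      else if t = F0 \<or> t = F1 then LMixed (2 * plain_class u b + low_bit t)
      else LPure (2 * (if u = 3 then 2 else if u = 5 then 3 else 4) + low_bit t))"

definition mark7 :: "(f4 \<Rightarrow> nat) \<Rightarrow> f4 \<Rightarrow> layer_mark" where
  "mark7 T t = mark_of (orbit7 T) (T F1) t"

lemma triple7_checked:
  "\<forall>x\<in>set [0..<7]. \<forall>u\<in>set [0..<7]. \<forall>b\<in>set [0..<7]. orbit7 (triple7 x u b) = u \<and>
     (triple7 x u b F0 + triple7 x u b F1 + triple7 x u b Fw + triple7 x u b Fv) mod 7 = 0"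
  by code_simp

lemma foot_checked:
  "\<forall>x\<in>set [0..<7]. \<forall>u\<in>set [0..<7]. \<forall>c\<in>set [0..<7]. \<forall>j\<in>set [F1, Fw, Fv].
     foot j (norm7 x j c) u < 7 \<and> triple7 x u (foot j (norm7 x j c) u) j = c"
  by code_simp

lemma determined_checked:
  "\<forall>x\<in>set [0..<7]. \<forall>b\<in>set [0..<7]. \<forall>c\<in>set [0..<7].
     let v = (6 * (x + b + c)) mod 7; u = (c + 5 * b) mod 7 in
     c = triple7 x u b Fw \<and> v = triple7 x u b Fv \<and>
     b = foot F1 (norm7 x F1 b) u \<and> b = foot Fw (norm7 x Fw c) u \<and> b = foot Fv (norm7 x Fv v) u"
  by code_simp

lemma pure_checked:
  "\<forall>p\<in>set [0..<13]. \<exists>u\<in>set [0..<7]. \<exists>t\<in>set [F0, F1, Fw, Fv]. \<forall>b\<in>set [0..<7]. mark_of u b t = LPure p"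
  by code_simp

lemma f4_nonzero: "j \<noteq> 0 \<Longrightarrow> j \<in> set [F1, Fw, Fv]"
  by (cases j) (simp_all add: zero_f4_def)

lemma triple7_through:
  assumes "x < 7" "u < 7" "c < 7" "j \<noteq> 0"
  defines "T \<equiv> triple7 x u (foot j (norm7 x j c) u)"
  shows "T \<in> through cube7 x j c" "mark7 T t = mark_of u (foot j (norm7 x j c) u) t"
    "foot j (norm7 x j c) u < 7"
proof -
  have foot: "foot j (norm7 x j c) u < 7" and c: "T j = c" unfolding T_def
    using foot_checked[rule_format, of x u c j] f4_nonzero[OF assms(4)] assms by auto
  show "foot j (norm7 x j c) u < 7" by (fact foot)
  have T: "orbit7 T = u" "(T F0 + T F1 + T Fw + T Fv) mod 7 = 0"
    using triple7_checked[rule_format, of x u "foot j (norm7 x j c) u"] foot assms by (auto simp: T_def)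
  have "T i < 7" for i using foot assms by (cases i) (simp_all add: T_def triple7_def)
  then show "T \<in> through cube7 x j c"
    using T(2) c by (simp add: through_def cube7_def) (simp add: T_def triple7_def zero_f4_def)
  show "mark7 T t = mark_of u (foot j (norm7 x j c) u) t"
    using T(1) by (simp add: mark7_def) (simp add: T_def triple7_def)
qed

text \<open>
  The orbit and one point on a level \<open>j \<noteq> 0\<close> determine a triple; this yields the uniqueness of broken
  layers.
\<close>
lemma through_cube7:
  assumes "T \<in> through cube7 x j c" "j \<noteq> 0"
  shows "T = triple7 x (orbit7 T) (foot j (norm7 x j c) (orbit7 T))"
proof -
  have T: "\<And>i. T i < 7" "T F0 = x" "T j = c" "(T F0 + T F1 + T Fw + T Fv) mod 7 = 0"
    using assms(1) by (auto simp: through_def cube7_def zero_f4_def)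
  have Fv: "(6 * (x + T F1 + T Fw)) mod 7 = T Fv"
  proof -
    have "(6 * (x + T F1 + T Fw)) mod 7 = (6 * (x + T F1 + T Fw) + (x + T F1 + T Fw + T Fv)) mod 7"
      using T(2,4) by (metis add_0_right mod_add_right_eq)
    also have "\<dots> = (7 * (x + T F1 + T Fw) + T Fv) mod 7" by (simp add: algebra_simps)
    also have "\<dots> = T Fv" using T(1)[of Fv] by (simp only: mod_mult_self4 mod_less)
    finally show ?thesis by simp
  qed
  have "x \<in> set [0..<7]" "T F1 \<in> set [0..<7]" "T Fw \<in> set [0..<7]"
    using T(1)[of F0] T(1)[of F1] T(1)[of Fw] T(2) by simp_all
  note determined = determined_checked[THEN bspec, OF this(1), THEN bspec, OF this(2),
    THEN bspec, OF this(3), unfolded Let_def Fv, folded orbit7_def]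
  have *: "T Fw = triple7 x (orbit7 T) (T F1) Fw" "T Fv = triple7 x (orbit7 T) (T F1) Fv"
    "T F1 = foot F1 (norm7 x F1 (T F1)) (orbit7 T)" "T F1 = foot Fw (norm7 x Fw (T Fw)) (orbit7 T)"
    "T F1 = foot Fv (norm7 x Fv (T Fv)) (orbit7 T)"
    using determined by blast+
  have "T F1 = foot j (norm7 x j c) (orbit7 T)"
    using *(3-5) T(3) assms(2) by (cases j) (simp_all add: zero_f4_def)
  moreover have "T i = triple7 x (orbit7 T) (T F1) i" for i
    using *(1,2) T(2) by (cases i) (simp_all add: triple7_def)
  ultimately show ?thesis by (metis ext)
qed

definition arc_mark :: "nat \<Rightarrow> f4 \<Rightarrow> nat \<Rightarrow> nat \<Rightarrow> f4 \<Rightarrow> f4 \<Rightarrow> nat" where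
  "arc_mark x j c d a b = 2 * arc_class j (norm7 x j c) (gap7 c d) + low_bit (a + hue c d * slope c d a b)"

definition edge_mark :: "nat \<Rightarrow> f4 \<Rightarrow> nat \<Rightarrow> nat \<Rightarrow> f4 \<Rightarrow> f4 \<Rightarrow> nat" where
  "edge_mark x j c d a b = (if starts c d a b then arc_mark x j c d a b else arc_mark x j d c b a)"

lemma symmetrize_edge_mark:
  "c < 7 \<Longrightarrow> d < 7 \<Longrightarrow> c \<noteq> d \<Longrightarrow> symmetrize (edge_mark x j) c d a b = edge_mark x j c d a b"
  by (auto simp: symmetrize_def edge_mark_def starts_sym[of c d])

lemma norm7_back:
  assumes "c < 7" "s < 7"
  shows "norm7 x j ((c + 7 - s) mod 7) = (norm7 x j c + 7 - s) mod 7"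
proof (cases "j = Fv")
  case True
  have "((c + 7 - s) mod 7 + x) mod 7 = (c + 7 - s + x) mod 7" by (simp add: mod_simps)
  also have "\<dots> = ((c + x) + (7 - s)) mod 7" using assms by (simp add: algebra_simps)
  also have "\<dots> = ((c + x) mod 7 + (7 - s)) mod 7" by (simp add: mod_simps)
  also have "\<dots> = ((c + x) mod 7 + 7 - s) mod 7" using assms by simp
  finally show ?thesis using True by (simp add: norm7_def)
qed (simp add: norm7_def)

lemma norm7_surj:
  assumes "x < 7" "n < 7"
  shows "\<exists>c<7. norm7 x j c = n"
proof (cases "j = Fv")
  case True
  have "((n + (7 - x)) mod 7 + x) mod 7 = (n + (7 - x) + x) mod 7" by (simp add: mod_simps)
  also have "\<dots> = n" using assms by simp
  finally show ?thesis using True by (intro exI[of _ "(n + (7 - x)) mod 7"]) (simp add: norm7_def)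
qed (use assms in \<open>auto simp: norm7_def\<close>)

lemma mixed_label_cases:
  assumes "r < 42"
  obtains q i where "i = 0 \<or> i = 1" "r = 2 * q + low_bit i" "q < 21"
proof (cases "even r")
  case True
  then show ?thesis using assms that[of 0 "r div 2"] by (simp add: low_bit_def zero_f4_def)
next
  case False
  then show ?thesis using assms that[of 1 "r div 2"] by (simp add: low_bit_def one_f4_def)
qed

text \<open>
  An arc of class \<open>q\<close> lifts to its two matchings, number \<open>i\<close> for the mixed class \<open>2 * q + i\<close>. Either
  matching has one edge of each colour \<open>(s, k)\<close>, where \<open>s\<close> is the difference of the arc.
\<close>
lemma layered_gadget_7:
  assumes x: "x < 7"
  shows "layered_gadget 7 cube7 (symmetrize arc_colour) x {..<13} {..<42} mark7
    (\<lambda>j. symmetrize (edge_mark x j))"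
proof (unfold_locales, goal_cases)
  case (5 c d j a b)
  then show ?case by (rule symmetrize_sym)
next
  case (6 p j c)
  then have "p \<in> set [0..<13]" by simp
  from pure_checked[THEN bspec, OF this] obtain u t where "u \<in> set [0..<7]"
    "\<forall>b\<in>set [0..<7]. mark_of u b t = LPure p" by blast
  then have u: "u < 7" "\<And>b. b < 7 \<Longrightarrow> mark_of u b t = LPure p" by simp_all
  then show ?case using triple7_through[OF x u(1) 6(3,2)] by metis
next
  case (7 r j c)
  obtain q i where i: "i = 0 \<or> i = 1" "r = 2 * q + low_bit i" and q: "q < 21"
    by (rule mixed_label_cases[of r]) (use 7(1) in auto)
  define n where "n = norm7 x j c"
  have n: "n < 7" using 7(3) by (simp add: n_def norm7_def)
  have "n \<in> set [0..<7]" "q \<in> set [0..<21]" using n q by simp_all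
  from cover_checked[THEN bspec, OF f4_nonzero[OF 7(2)], THEN bspec, OF this(1), THEN bspec, OF this(2)]
  consider
      (split) u where "u \<in> set [1, 2, 4]" "q = split_class u (foot j n u)"
    | (plain) u where "u \<in> set [1, 2, 3, 4, 5, 6]" "q = plain_class u (foot j n u)"
    | (out) s where "s \<in> set [1, 2, 3, 4, 5, 6]" "q = arc_class j n s"
    | (into) s where "s \<in> set [1, 2, 3, 4, 5, 6]" "q = arc_class j ((n + 7 - s) mod 7) s"
    unfolding set_map by blast
  then show ?case
  proof cases
    case split
    then have "u < 7" by auto
    note T = triple7_through[OF x this 7(3,2)]
    have "mark_of u (foot j n u) F0 = Split (tag u) (2 * q) (2 * q + 1)" "tag u \<noteq> 0"
      using split by (auto simp: mark_of_def tag_def zero_f4_def)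
    then have "\<exists>s. mark_of u (foot j n u) F0 = Split (tag u) r s \<or>
        mark_of u (foot j n u) F0 = Split (tag u) s r"
      using i by (auto simp: low_bit_def zero_f4_def one_f4_def)
    then show ?thesis using T(1,2)[folded n_def] \<open>tag u \<noteq> 0\<close> by metis
  next
    case plain
    then have "u < 7" by auto
    note T = triple7_through[OF x this 7(3,2)]
    have "\<exists>t. mark_of u (foot j n u) t = LMixed r"
    proof (cases "u \<in> {1, 2, 4}")
      case True
      then show ?thesis using i plain
        by (intro exI[of _ "Fw + i"]) (auto simp: mark_of_def low_bit_def zero_f4_def one_f4_def)
    next
      case False
      then show ?thesis using i plain
        by (intro exI[of _ i]) (auto simp: mark_of_def low_bit_def zero_f4_def one_f4_def)
    qed
    then show ?thesis using T(1,2)[folded n_def] by metis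
  next
    case out
    define d where "d = (c + s) mod 7"
    have s: "s < 7" "s \<noteq> 0" using out by auto
    have d: "d < 7" "gap7 c d = s" using gap7_forward[OF 7(3) s(1)] by (simp_all add: d_def)
    then have ne: "d \<noteq> c" using s gap7_eq_0[of c d] 7(3) by auto
    have h: "hue c d \<noteq> 0" using hue_nonzero[of c d] d ne 7(3) by simp
    have "\<exists>b. edge_mark x j c d a b = r" for a
    proof -
      \<comment> \<open>The matching number \<open>i\<close> has an edge at copy \<open>a\<close> of \<open>c\<close> for this value of \<open>k\<close>.\<close>
      define k where "k = (a + i) / hue c d"
      have k: "a + hue c d * k = i" using h by (simp add: k_def)
      obtain b where "slope c d a b = k" "starts c d a b \<longleftrightarrow> a + hue c d * k \<in> {0, 1}"
        by (rule solve_slope[of c d a k]) (use 7(3) d ne in auto)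
      then show ?thesis using k i out d
        by (intro exI[of _ b]) (auto simp: edge_mark_def arc_mark_def n_def)
    qed
    then show ?thesis using d ne 7(3) symmetrize_edge_mark[of c d] by metis
  next
    case into
    define d where "d = (c + 7 - s) mod 7"
    have s: "s < 7" "s \<noteq> 0" using into by auto
    have d: "d < 7" "gap7 d c = s" "norm7 x j d = (n + 7 - s) mod 7"
      using gap7_backward[OF 7(3) s(1)] norm7_back[OF 7(3) s(1)] by (simp_all add: d_def n_def)
    then have ne: "d \<noteq> c" using s gap7_eq_0[of d c] 7(3) by auto
    have h: "hue c d \<noteq> 0" using hue_nonzero[of c d] d ne 7(3) by simp
    have "\<exists>b. edge_mark x j c d a b = r" for a
    proof -
      \<comment> \<open>Here \<open>c\<close> is the end of the arc, where the matching number \<open>i\<close> uses the translate by \<open>Fw\<close>.\<close>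
      define k where "k = (a + (i + Fw)) / hue c d"
      have k: "a + hue c d * k = i + Fw" using h by (simp add: k_def)
      have "i + Fw \<notin> {0, 1}" using i by (auto simp: f4_arith)
      then obtain b where b: "slope c d a b = k" "\<not> starts c d a b"
        by (metis solve_slope[of c d a k] 7(3) d(1) ne k)
      have "b = a + hue c d * k + hue d c * k + Fw"
        using slope_iff[of c d a b k] b(1) 7(3) d(1) ne by simp
      then have "b + hue d c * k = i" unfolding k by (simp add: add_ac)
      then show ?thesis using b i into d slope_sym[of c d a b]
        by (intro exI[of _ b]) (auto simp: edge_mark_def arc_mark_def)
    qed
    then show ?thesis using d ne 7(3) symmetrize_edge_mark[of c d] by metis
  qed
next
  case (8 r y a b)
  obtain q i where i: "i = 0 \<or> i = 1" "r = 2 * q + low_bit i" and q: "q < 21"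
    by (rule mixed_label_cases[of r]) (use 8(1) in auto)
  define k where "k = slope x y a b"
  obtain s where s: "s < 7" "s \<noteq> 0" "symmetrize arc_colour x y a b = pt s k"
    using 8 x gap7_eq_0[of x y] gap7_eq_0[of y x] gap7_lt symmetrize_arc_colour[of x y a b]
    by (cases "starts x y a b") (auto simp: arc_colour_def k_def)
  then have "s \<in> set [1, 2, 3, 4, 5, 6]" "q \<in> set [0..<21]" using q by auto
  from rainbow_checked[THEN bspec, OF this(2), THEN bspec, OF this(1)]
  obtain j n where "j \<in> set [F1, Fw, Fv]" "n \<in> set [0..<7]" "arc_class j n s = q" by blast
  then have j: "j \<in> {F1, Fw, Fv}" "n < 7" "arc_class j n s = q" by simp_all
  then have "j \<noteq> 0" by (auto simp: zero_f4_def)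
  obtain c where c: "c < 7" "norm7 x j c = n" using norm7_surj[OF x j(2)] by blast
  define d where "d = (c + s) mod 7"
  have d: "d < 7" "gap7 c d = s" using gap7_forward[OF c(1) s(1)] by (simp_all add: d_def)
  then have ne: "c \<noteq> d" using s gap7_eq_0[of c d] c by auto
  define a' where "a' = i + hue c d * k"
  have a': "a' + hue c d * k = i" by (simp add: a'_def add.assoc)
  obtain b' where b': "slope c d a' b' = k" "starts c d a' b'"
    using solve_slope[OF c(1) d(1) ne, of a' k] a' i by auto
  have "symmetrize arc_colour c d a' b' = pt s k"
    using symmetrize_arc_colour[OF c(1) d(1) ne] b' d by (simp add: arc_colour_def)
  moreover have "symmetrize (edge_mark x j) c d a' b' = r"
    using symmetrize_edge_mark[OF c(1) d(1) ne] b' d a' c i j by (simp add: edge_mark_def arc_mark_def)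
  ultimately show ?case using \<open>j \<noteq> 0\<close> c d ne s by metis
next
  case (9 r)
  then have "r div 2 \<in> set [0..<21]" by simp
  from split_checked[THEN bspec, OF this] obtain u b where
    "u \<in> set [1, 2, 4]" "b \<in> set [0..<7]" "split_class u b = r div 2" by blast
  then have u: "u \<in> {1, 2, 4}" "b < 7" "split_class u b = r div 2" by simp_all
  then have "u < 7" by auto
  note T = triple7_through[OF x this u(2), of F1]
  have foot: "foot F1 (norm7 x F1 b) u = b" by (simp add: foot_def norm7_def)
  have "\<exists>s. mark_of u b F0 = Split (tag u) r s \<or> mark_of u b F0 = Split (tag u) s r"
    using u by (cases "even r") (auto simp: mark_of_def elim: oddE)
  moreover have "tag u \<noteq> 0" by (simp add: tag_def zero_f4_def)
  moreover have "triple7 x u b \<in> cube7" "triple7 x u b 0 = x"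
    "\<And>t. mark7 (triple7 x u b) t = mark_of u b t"
    using T[unfolded foot] by (simp_all add: through_def zero_f4_def)
  ultimately show ?case by metis
next
  case (10 m j c)
  define u where "u = (if m = F1 then 1 else if m = Fw then 2 else 4 :: nat)"
  have u: "u < 7" by (simp add: u_def)
  let ?T = "triple7 x u (foot j (norm7 x j c) u)"
  have mark: "(\<exists>r s. mark_of u' b t = Split m r s) \<longleftrightarrow> u' = u \<and> t = F0" for u' b t
    using 10(1) by (cases m) (auto simp: mark_of_def tag_def u_def zero_f4_def)
  note T = triple7_through[OF x u 10(3,2)]
  show ?case
  proof (rule ex1I[of _ "(?T, F0)"])
    show "fst (?T, F0) \<in> through cube7 x j c \<and> (\<exists>r s. mark7 (fst (?T, F0)) (snd (?T, F0)) = Split m r s)"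
      using T(1) unfolding fst_conv snd_conv T(2) mark by simp
  next
    fix z assume z: "fst z \<in> through cube7 x j c \<and> (\<exists>r s. mark7 (fst z) (snd z) = Split m r s)"
    then have "orbit7 (fst z) = u" "snd z = F0" unfolding mark7_def mark by simp_all
    with through_cube7[of "fst z" x j c] z 10(2) show "z = (?T, F0)" by (cases z) simp
  qed
qed simp_all

lemma has_layered_gadgets_7: "has_layered_gadgets 7"
  using cube_cube7 layered_factorization_arc_colour layered_gadget_7
  unfolding has_layered_gadgets_def by blast

section \<open>The quadruple system on 28 points\<close>

text \<open>
  The thirteen parallel classes of lines of the affine space of dimension three over the field with
  three elements. A Singer cycle permutes the 28 points of the projective line over the field with 27
  elements cyclically and identifies them with the residues modulo 28; with 0 as the point at infinity,
  the affine points become the nonzero residues.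
\<close>
definition kts27 :: "(int \<times> int \<times> int) list list" where
  "kts27 = [
  [(1,2,15), (3,11,18), (4,21,23), (5,7,24), (6,14,22), (8,9,12), (10,17,25), (13,26,27), (16,19,20)],
  [(1,3,7), (2,5,18), (4,13,17), (6,12,20), (8,16,22), (9,14,19), (10,23,26), (11,15,24), (21,25,27)],
  [(1,4,20), (2,19,23), (3,6,17), (5,9,26), (7,12,13), (8,24,27), (10,14,18), (11,22,25), (15,16,21)],
  [(1,5,11), (2,3,24), (4,25,26), (6,8,19), (7,15,18), (9,20,22), (10,13,21), (12,14,16), (17,23,27)],
  [(1,6,13), (2,14,26), (3,4,12), (5,10,19), (7,17,20), (8,11,21), (9,18,23), (15,22,27), (16,24,25)],
  [(1,8,10), (2,12,25), (3,16,26), (4,14,24), (5,6,21), (7,22,23), (9,15,17), (11,13,19), (18,20,27)],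
  [(1,9,25), (2,8,17), (3,19,27), (4,5,22), (6,23,24), (7,14,21), (10,12,15), (11,20,26), (13,16,18)],
  [(1,12,17), (2,9,10), (3,13,20), (4,6,7), (5,14,23), (8,15,25), (11,16,27), (18,19,26), (21,22,24)],
  [(1,14,27), (2,13,22), (3,9,21), (4,8,18), (5,16,17), (6,15,26), (7,19,25), (10,20,24), (11,12,23)],
  [(1,16,23), (2,20,21), (3,10,22), (4,15,19), (5,12,27), (6,18,25), (7,8,26), (9,13,24), (11,14,17)],
  [(1,18,24), (2,7,11), (3,5,15), (4,10,27), (6,9,16), (8,14,20), (12,19,22), (13,23,25), (17,21,26)],
  [(1,19,21), (2,4,16), (3,14,25), (5,8,13), (6,10,11), (7,9,27), (12,24,26), (15,20,23), (17,18,22)],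
  [(1,22,26), (2,6,27), (3,8,23), (4,9,11), (5,20,25), (7,10,16), (12,18,21), (13,14,15), (17,19,24)]]"

fun others :: "int \<Rightarrow> int \<times> int \<times> int \<Rightarrow> int list" where
  "others a (p, q, r) =
     (if p = a then [q, r] else if q = a then [p, r] else if r = a then [p, q] else [])"

definition near :: "int \<Rightarrow> int list" where
  "near a = concat (map (others a) (concat kts27))"

definition kts27_labelled :: "((int \<times> int \<times> int) \<times> nat) list" where
  "kts27_labelled = concat (map (\<lambda>i. map (\<lambda>t. (t, i)) (kts27 ! i)) [0..<13])"

text \<open>
  Every point other than \<open>a\<close> lies on exactly one line with \<open>a\<close>.
\<close>
lemma kts27_near:
  "\<forall>a\<in>set [1..27]. distinct (near a) \<and> (\<forall>b\<in>set [1..27]. b = a \<or> b \<in> set (near a))"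
  by code_simp

lemma kts27_parallel:
  "\<forall>P\<in>set kts27. \<forall>a\<in>set [1..27]. \<exists>(p, q, r)\<in>set P. a = p \<or> a = q \<or> a = r"
  by code_simp

lemma kts27_distinct: "distinct (map fst kts27_labelled)"
  by code_simp

text \<open>
  The blocks of the spherical geometry through 0 are the lines with 0 added. Translating such a block so
  that one of its points moves to 0 yields another one; hence all blocks are translates of these. The
  differences are written in increasing order, as the entries of a line are.
\<close>
lemma kts27_closed:
  "\<forall>(p, q, r)\<in>set (concat kts27). 0 < p \<and> p < q \<and> q < r \<and> r < 28 \<and>
     (\<exists>P\<in>set kts27. (q - p, r - p, 28 - p) \<in> set P) \<and>
     (\<exists>P\<in>set kts27. (r - q, 28 - q, 28 + p - q) \<in> set P) \<and>
     (\<exists>P\<in>set kts27. (28 - r, 28 + p - r, 28 + q - r) \<in> set P)"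
  by code_simp

lemma length_kts27: "length kts27 = 13"
  by code_simp

text \<open>
  The difference modulo 28, by cases instead of \<open>mod\<close> so that linear arithmetic applies.
\<close>
definition gap :: "nat \<Rightarrow> nat \<Rightarrow> int" where
  "gap x y = (if x \<le> y then int y - int x else int y - int x + 28)"

definition step :: "nat \<Rightarrow> int \<Rightarrow> nat" where
  "step x z = (if int x + z < 28 then nat (int x + z) else nat (int x + z - 28))"

lemma gap_range: "x < 28 \<Longrightarrow> y < 28 \<Longrightarrow> 0 \<le> gap x y \<and> gap x y < 28"
  by (auto simp: gap_def)

lemma gap_eq_0_iff: "x < 28 \<Longrightarrow> y < 28 \<Longrightarrow> gap x y = 0 \<longleftrightarrow> y = x"
  by (auto simp: gap_def)

lemma gap_inj: "x < 28 \<Longrightarrow> y < 28 \<Longrightarrow> z < 28 \<Longrightarrow> gap x y = gap x z \<Longrightarrow> y = z"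
  by (auto simp: gap_def split: if_splits)

lemma step_lt: "x < 28 \<Longrightarrow> 0 \<le> z \<Longrightarrow> z < 28 \<Longrightarrow> step x z < 28"
  by (auto simp: step_def)

lemma gap_step: "x < 28 \<Longrightarrow> 0 \<le> z \<Longrightarrow> z < 28 \<Longrightarrow> gap x (step x z) = z"
  by (auto simp: step_def gap_def)

lemma gap_gap: "x < 28 \<Longrightarrow> y < 28 \<Longrightarrow> z < 28 \<Longrightarrow>
    gap y z = (if gap x y \<le> gap x z then gap x z - gap x y else gap x z - gap x y + 28)"
  by (auto simp: gap_def)

fun line :: "int \<times> int \<times> int \<Rightarrow> int set" where "line (p, q, r) = {p, q, r}"

definition lines :: "(int \<times> int \<times> int) set" where
  "lines = set (concat kts27)"

definition block_at :: "nat \<Rightarrow> int \<times> int \<times> int \<Rightarrow> nat set" where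
  "block_at x t = {y. y < 28 \<and> gap x y \<in> insert 0 (line t)}"

definition sqs28 :: "nat set set" where
  "sqs28 = {block_at x t | x t. x < 28 \<and> t \<in> lines}"

lemma lines_sorted: "(p, q, r) \<in> lines \<Longrightarrow> 0 < p \<and> p < q \<and> q < r \<and> r < 28"
  using kts27_closed unfolding lines_def by blast

lemma lines_shift:
  assumes "(p, q, r) \<in> lines"
  shows "(q - p, r - p, 28 - p) \<in> lines" "(r - q, 28 - q, 28 + p - q) \<in> lines"
    "(28 - r, 28 + p - r, 28 + q - r) \<in> lines"
  using kts27_closed assms unfolding lines_def by auto

lemma set_others:
  assumes "t \<in> lines"
  shows "set (others a t) = (if a \<in> line t then line t - {a} else {})"
proof (cases t)
  case (fields p q r)
  then show ?thesis using lines_sorted[of p q r] assms by auto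
qed

lemma line_through_pair:
  assumes "0 < a" "a < 28" "0 < b" "b < 28" "a \<noteq> b"
  shows "\<exists>t\<in>lines. a \<in> line t \<and> b \<in> line t"
proof -
  have ab: "a \<in> set [1..27]" "b \<in> set [1..27]" using assms by auto
  have "b \<in> set (near a)"
    using kts27_near[THEN bspec, OF ab(1), THEN conjunct2, THEN bspec, OF ab(2)] assms(5) by simp
  then obtain t where t: "t \<in> lines" "b \<in> set (others a t)"
    unfolding near_def set_concat set_map lines_def by blast
  then have "a \<in> line t" "b \<in> line t" using set_others[OF t(1), of a] by (auto split: if_splits)
  with t show ?thesis by blast
qed

lemma line_eqI:
  assumes "s \<in> lines" "t \<in> lines" "a \<in> line s" "b \<in> line s" "a \<in> line t" "b \<in> line t" "a \<noteq> b"
  shows "line s = line t"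
proof -
  obtain p q r where s: "s = (p, q, r)" by (cases s)
  have "a \<in> set [1..27]" using assms(1,3) lines_sorted[of p q r] by (auto simp: s)
  from kts27_near[THEN bspec, OF this] have "distinct (near a)" by simp
  moreover have "others a s \<in> set (map (others a) (concat kts27))"
      "others a t \<in> set (map (others a) (concat kts27))"
    using assms(1,2) unfolding lines_def set_map by (blast intro: imageI)+
  moreover have "b \<in> set (others a s) \<inter> set (others a t)"
    using assms by (simp add: set_others)
  ultimately have "others a s = others a t"
    unfolding near_def distinct_concat_iff by blast
  then have "line s - {a} = line t - {a}"
    using set_others[OF assms(1), of a] set_others[OF assms(2), of a] assms(3,5) by simp
  then show ?thesis using assms(3,5) by blast
qed

text \<open>
  A block can be described from any of its points, because the system is cyclic. This reduces the
  triples of points through \<open>x\<close> to pairs of residues and blocks to lines.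
\<close>
lemma block_at_shift:
  assumes "x < 28" "t \<in> lines" "y \<in> block_at x t"
  shows "\<exists>s\<in>lines. block_at x t = block_at y s"
proof (cases "y = x")
  case False
  have y: "y < 28" "gap x y \<in> line t"
    using assms False by (auto simp: block_at_def gap_eq_0_iff)
  obtain p q r where t: "t = (p, q, r)" by (cases t)
  note sorted = lines_sorted[OF assms(2)[unfolded t]]
  note shifts = lines_shift[OF assms(2)[unfolded t]]
  define s where "s = (if gap x y = p then (q - p, r - p, 28 - p)
    else if gap x y = q then (r - q, 28 - q, 28 + p - q)
    else (28 - r, 28 + p - r, 28 + q - r))"
  have "gap y z \<in> insert 0 (line s) \<longleftrightarrow> gap x z \<in> insert 0 (line t)" if "z < 28" for z
    using y(2) sorted gap_range[OF assms(1) that] gap_range[OF assms(1) y(1)]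
    unfolding gap_gap[OF assms(1) y(1) that] s_def t by (auto split: if_splits)
  then have "block_at x t = block_at y s" unfolding block_at_def by blast
  moreover have "s \<in> lines" using shifts by (simp add: s_def)
  ultimately show ?thesis by blast
qed (use assms in auto)

lemma sqs28_at:
  assumes "b \<in> sqs28" "y \<in> b"
  obtains t where "t \<in> lines" "b = block_at y t"
  using assms block_at_shift unfolding sqs28_def by blast

lemma block_at_in_sqs28: "x < 28 \<Longrightarrow> t \<in> lines \<Longrightarrow> block_at x t \<in> sqs28"
  unfolding sqs28_def by blast

lemma self_in_block_at: "x < 28 \<Longrightarrow> x \<in> block_at x t"
  by (simp add: block_at_def gap_def)

lemma steiner_quadruple_system_28: "steiner_quadruple_system 28 {..<28} sqs28"
  unfolding steiner_quadruple_system_def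
proof (intro conjI ballI allI impI)
  fix b assume "b \<in> sqs28"
  then obtain x p q r where b: "b = block_at x (p, q, r)" "x < 28" "(p, q, r) \<in> lines"
    by (auto simp: sqs28_def)
  note sorted = lines_sorted[OF b(3)]
  have "b = step x ` {0, p, q, r}"
  proof (intro equalityI subsetI)
    fix y assume "y \<in> b"
    then have "y < 28" "gap x y \<in> {0, p, q, r}" by (auto simp: b block_at_def)
    moreover have "step x (gap x y) = y" if "y < 28" using b(2) that by (auto simp: step_def gap_def)
    ultimately show "y \<in> step x ` {0, p, q, r}" by (metis imageI)
  qed (use sorted b(2) in \<open>auto simp: b block_at_def gap_step step_lt\<close>)
  moreover have "inj_on (step x) {0, p, q, r}"
    by (rule inj_on_inverseI[of _ "gap x"]) (use sorted b(2) in \<open>auto simp: gap_step\<close>)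
  moreover have "card {0, p, q, r} = 4" using sorted by simp
  ultimately show "card b = 4" by (simp only: card_image)
  show "b \<subseteq> {..<28}" by (auto simp: b block_at_def)
next
  fix T :: "nat set" assume T: "T \<subseteq> {..<28} \<and> card T = 3"
  then obtain x y z where xyz: "T = {x, y, z}" "x \<noteq> y" "x \<noteq> z" "y \<noteq> z"
    by (auto simp: card_3_iff)
  then have lt: "x < 28" "y < 28" "z < 28" using T by auto
  have ne: "gap x y \<noteq> 0" "gap x z \<noteq> 0" "gap x y \<noteq> gap x z"
    using xyz lt gap_inj by (auto simp: gap_eq_0_iff)
  then have "0 < gap x y" "0 < gap x z" "gap x y < 28" "gap x z < 28"
    using gap_range[of x y] gap_range[of x z] lt by auto
  then obtain t where t: "t \<in> lines" "gap x y \<in> line t" "gap x z \<in> line t"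
    using line_through_pair ne(3) by blast
  show "\<exists>!b. b \<in> sqs28 \<and> T \<subseteq> b"
  proof (rule ex1I[of _ "block_at x t"])
    show "block_at x t \<in> sqs28 \<and> T \<subseteq> block_at x t"
      using t lt xyz self_in_block_at[OF lt(1)] block_at_in_sqs28 by (simp add: block_at_def)
  next
    fix b assume b: "b \<in> sqs28 \<and> T \<subseteq> b"
    then obtain s where s: "s \<in> lines" "b = block_at x s"
      using sqs28_at[of b x] xyz by auto
    then have "gap x y \<in> line s" "gap x z \<in> line s"
      using b xyz ne by (auto simp: block_at_def)
    then have "line s = line t" using line_eqI s t ne(3) by blast
    then show "b = block_at x t" using s by (simp add: block_at_def)
  qed
qed auto

lemma kts27_labelled_iff: "(t, i) \<in> set kts27_labelled \<longleftrightarrow> i < 13 \<and> t \<in> set (kts27 ! i)"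
  by (auto simp: kts27_labelled_def)

lemma line_inj:
  assumes "s \<in> lines" "t \<in> lines" "line s = line t"
  shows "s = t"
proof -
  obtain p q r p' q' r' where st: "s = (p, q, r)" "t = (p', q', r')" by (cases s; cases t)
  have "sorted [p, q, r]" "sorted [p', q', r']" "distinct [p, q, r]" "distinct [p', q', r']"
    using lines_sorted assms st by fastforce+
  moreover have "set [p, q, r] = set [p', q', r']" using assms(3) st by simp
  ultimately have "[p, q, r] = [p', q', r']" using sorted_distinct_set_unique by blast
  then show ?thesis using st by simp
qed

lemma has_kirkman_sqs_28: "has_kirkman_sqs 28"
proof -
  have "\<exists>(f :: nat set \<Rightarrow> nat) P. finite P \<and> 2 * card P + 2 = 28 \<and>
      (\<forall>p\<in>P. \<forall>y<28. y \<noteq> x \<longrightarrow> (\<exists>b\<in>sqs28. x \<in> b \<and> y \<in> b \<and> f b = p))" if x: "x < 28" for x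
  proof -
    define f where "f b = (THE i. \<exists>t. (t, i) \<in> set kts27_labelled \<and> b = block_at x t)" for b
    have in_lines: "t \<in> lines" if "(t, i) \<in> set kts27_labelled" for t i
      using that length_kts27 unfolding kts27_labelled_iff lines_def by (auto intro: nth_mem)
    have f: "f (block_at x t) = i" if t: "(t, i) \<in> set kts27_labelled" for t i
      unfolding f_def
    proof (rule the_equality)
      fix j assume "\<exists>s. (s, j) \<in> set kts27_labelled \<and> block_at x t = block_at x s"
      then obtain s where s: "(s, j) \<in> set kts27_labelled" "block_at x t = block_at x s" by blast
      have "line u = gap x ` (block_at x u - {x})" if "u \<in> lines" for u
      proof (intro equalityI subsetI)
        fix z assume z: "z \<in> line u"
        obtain p q r where "u = (p, q, r)" by (cases u)
        then have "0 < z" "z < 28" using z lines_sorted[of p q r] that by auto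
        then have y: "gap x (step x z) = z" "step x z < 28" using x gap_step step_lt by auto
        then have "step x z \<noteq> x" using gap_eq_0_iff[OF x y(2)] \<open>0 < z\<close> by auto
        with y z show "z \<in> gap x ` (block_at x u - {x})"
          by (intro image_eqI[of _ _ "step x z"]) (simp_all add: block_at_def)
      qed (use x in \<open>auto simp: block_at_def gap_eq_0_iff\<close>)
      then have "line s = line t" using s t in_lines by metis
      then have "s = t" using line_inj in_lines s t by blast
      then show "j = i" using s t kts27_distinct eq_key_imp_eq_value by metis
    qed (use t in blast)
    have "\<exists>b\<in>sqs28. x \<in> b \<and> y \<in> b \<and> f b = p" if "p < 13" "y < 28" "y \<noteq> x" for p y
    proof -
      have "kts27 ! p \<in> set kts27" using that length_kts27 by simp
      moreover have "gap x y \<in> set [1..27]"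
        using gap_range[OF x that(2)] gap_eq_0_iff[OF x that(2)] that(3) by auto
      ultimately obtain a b c where abc: "(a, b, c) \<in> set (kts27 ! p)" "gap x y \<in> {a, b, c}"
        using kts27_parallel by blast
      then have t: "((a, b, c), p) \<in> set kts27_labelled" using that by (simp add: kts27_labelled_iff)
      have "y \<in> block_at x (a, b, c)" using abc(2) that(2) by (simp add: block_at_def)
      then show ?thesis
        using f[OF t] block_at_in_sqs28[OF x in_lines[OF t]] self_in_block_at[OF x] by blast
    qed
    then show ?thesis by (intro exI[of _ f] exI[of _ "{..<13}"]) auto
  qed
  then show ?thesis using steiner_quadruple_system_28 unfolding has_kirkman_sqs_def by blast
qed

section \<open>The infinite family\<close>

text \<open>
  Alternate between lifting to four times as many points and reading the result as layered again.
\<close>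
lemma has_layered_gadgets_7_4_power: "has_layered_gadgets (7 * 4 ^ k)"
proof (induction k)
  case 0
  show ?case using has_layered_gadgets_7 by simp
next
  case (Suc k)
  then have "has_layered_gadgets (4 * (7 * 4 ^ k))"
    by (rule has_layered_gadgets_expand[OF has_gadgets_lift])
  then show ?case by (simp add: mult.left_commute)
qed

lemma has_kirkman_sqs_7_4_power: "has_kirkman_sqs (7 * 4 ^ Suc k)"
proof (induction k)
  case 0
  show ?case using has_kirkman_sqs_28 by simp
next
  case (Suc k)
  have "has_gadgets (7 * 4 ^ Suc k)"
    using has_gadgets_lift[OF has_layered_gadgets_7_4_power[of k]] by (simp add: mult.left_commute)
  from has_kirkman_sqs_quadruple[OF Suc this] show ?case by (simp add: mult.left_commute)
qed

theorem theorem3p3: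
  fixes n :: nat
  assumes "n \<ge> 1"
  shows "\<exists>(X :: nat set) \<B>. RDSQS (7 * 4 ^ n) X \<B>"
proof -
  obtain k where k: "n = Suc k" using assms by (cases n) auto
  have "7 * 4 ^ Suc k \<ge> (4 :: nat)" using one_le_power[of "4 :: nat" k] by simp
  with has_kirkman_sqs_7_4_power[of k] show ?thesis
    unfolding k using RDSQS_if_kirkman_sqs by blast
qed

end
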